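(* Let $f:\mathbb{R}^{m\times n}\to\mathbb{R}$ ($m\le n$) be continuously differentiable and satisfy the following assumptions. (a) There is a finite $f_{\mathrm{low}}$ with $f(X)\ge f_{\mathrm{low}}$ for all $X\in\mathbb{R}^{m\times n}$. (b) There are a conjugate pair $p\in[2,\infty]$, $q\in[1,2]$ and $L_{p,q}>0$ with $\|\nabla f(Y)-\nabla f(X)\|_{S_q}\le L_{p,q}\|Y-X\|_{S_p}$ for all $X,Y\in\mathbb{R}^{m\times n}$. (c) There is $V\in\mathbb{R}^{m\times m}$ such that the stochastic gradient estimator $G:\mathbb{R}^{m\times n}\times\Xi\to\mathbb{R}^{m\times n}$ satisfies, for all $X\in\mathbb{R}^{m\times n}$, $\mathbb{E}[G(X;\xi)]=\nabla f(X)$ and $\mathbb{E}[(G(X;\xi)-\nabla f(X))(G(X;\xi)-\nabla f(X))^T]\preceq VV^T$. Let $B\ge1$ be an integer, $\Delta_f:=f(X_0)-f_{\mathrm{low}}$ and $\sigma_{q,B}:=\|V\|_{S_q}/\sqrt{B}$. Let $K\ge1$ be any integer, and let $\{X_k\}$ be generated by the $S_p$-$S_q$ method with regularization oracle (see context) with this $p$, batch size $B$ and parameters $$\eta=\frac{\theta}{4L_{p,q}},\qquad \theta=\min\left\{\sqrt{\frac{L_{p,q}\Delta_f+\sigma_{q,B}^2}{\sigma_{q,B}^2K}},\,1\right\}$$ (with $\theta=1$ if $\sigma_{q,B}=0$). Then $$\frac{1}{K}\sum_{k=0}^{K-1}\mathbb{E}[\|\nabla f(X_k)\|_{S_q}^2]\le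 67\left[\sqrt{\frac{\sigma_{q,B}^2(L_{p,q}\Delta_f+\sigma_{q,B}^2)}{K}}+\frac{L_{p,q}\Delta_f+\sigma_{q,B}^2}{K}\right].$$
   Context: For $r\in[1,\infty]$, $\|Z\|_{S_r}$ is the Schatten-$r$ norm (the $\ell_r$ norm of the vector of singular values of $Z$). $p,q\in[1,\infty]$ are conjugate if $1/p+1/q=1$ with $1/\infty:=0$. $\langle\cdot,\cdot\rangle$ is the trace inner product. $A_1\preceq A_2$ means $A_2-A_1$ is positive semidefinite. $\xi$ is a random element of the measurable space $\Xi$ and $G$ is measurable. The $S_p$-$S_q$ method with regularization oracle: inputs are a (deterministic) starting point $X_0\in\mathbb{R}^{m\times n}$, $\theta\in(0,1]$, $p\in[2,\infty]$, $\eta>0$, and an integer batch size $B\ge1$. For $k=0,1,2,\dots$: draw $\xi_{k,1},\dots,\xi_{k,B}$, i.i.d. copies of $\xi$ independent of all previous samples, and set $\bar G_k=\frac1B\sum_{i=1}^BG(X_k;\xi_{k,i})$; set $M_0=\bar G_0$ and $M_k=(1-\theta)M_{k-1}+\theta\bar G_k$ for $k\ge1$; let $X_{k+1}$ be a minimizer over $X\in\mathbb{R}^{m\times n}$ of $\langle M_k,X-X_k\rangle+\frac{1}{2\eta}\|X-X_k\|_{S_p}^2$ (when the minimizer is not unique, it is selected so that $X_{k+1}$ is measurable with respect to $\sigma(\{\xi_{s,i}:0\le s\le k,\,1\le i\le B\})$). *)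

theory Defs
  imports
    "HOL-Probability.Probability"
    "HOL-Computational_Algebra.Computational_Algebra"
begin

text \<open>
  An \<open>m \<times> n\<close> real matrix has type \<open>real ^ 'n ^ 'm\<close>. On this type the inner product of
  HOL-Analysis is the trace inner product, so \<open>inner\<close> and \<open>GDERIV\<close> (the gradient with
  respect to \<open>inner\<close>) are used directly.
\<close>

lemma inner_matrix_eq_trace:
  fixes A B :: "real ^ 'n ^ 'm"
  shows "inner A B = trace (transpose A ** B)"
proof -
  have "inner A B = (\<Sum>i\<in>UNIV. \<Sum>j\<in>UNIV. A $ i $ j * B $ i $ j)"
    by (simp add: inner_vec_def)
  also have "\<dots> = (\<Sum>j\<in>UNIV. \<Sum>i\<in>UNIV. A $ i $ j * B $ i $ j)"
    by (rule sum.swap)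
  finally show ?thesis
    by (simp add: trace_def matrix_matrix_mult_def transpose_def)
qed

definition charpoly :: "real ^ 'm ^ 'm \<Rightarrow> real poly" where
  "charpoly A = det (\<chi> i j. (if i = j then [:0, 1:] else 0) - [:A $ i $ j:])"

text \<open>
  The square roots of the eigenvalues of \<open>Z Z\<^sup>T\<close>, with multiplicity. Since \<open>Z Z\<^sup>T\<close> is
  symmetric and positive semidefinite, its characteristic polynomial splits over the reals
  with nonnegative roots, so this multiset has exactly \<open>CARD('m)\<close> elements. If
  \<open>CARD('m) > CARD('n)\<close>, the surplus elements are zeros, which do not affect the norms below.
\<close>
definition singular_values :: "real ^ 'n ^ 'm \<Rightarrow> real multiset" where
  "singular_values Z = image_mset sqrt (proots (charpoly (Z ** transpose Z)))"

text \<open>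
  Meant for \<open>1 \<le> r \<le> \<infinity>\<close>. Zero singular values contribute \<open>0 powr r = 0\<close>.
\<close>
definition schatten_norm :: "ereal \<Rightarrow> real ^ 'n ^ 'm \<Rightarrow> real" where
  "schatten_norm r Z =
     (if r = \<infinity> then Max (set_mset (singular_values Z))
      else (\<Sum>s\<in>#singular_values Z. s powr real_of_ereal r) powr (1 / real_of_ereal r))"

definition positive_semidefinite :: "real ^ 'm ^ 'm \<Rightarrow> bool" where
  "positive_semidefinite A \<longleftrightarrow> transpose A = A \<and> (\<forall>v. 0 \<le> inner v (A *v v))"

definition loewner_le :: "real ^ 'm ^ 'm \<Rightarrow> real ^ 'm ^ 'm \<Rightarrow> bool" where
  "loewner_le A\<^sub>1 A\<^sub>2 \<longleftrightarrow> positive_semidefinite (A\<^sub>2 - A\<^sub>1)"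

text \<open>
  Sampling: all \<open>\<xi>\<^sub>k\<^sub>,\<^sub>i\<close> with \<open>k \<ge> 0\<close> and \<open>1 \<le> i \<le> B\<close> are jointly independent and have the
  distribution of \<open>\<xi>\<close>.
\<close>
definition iid_copies ::
  "'w measure \<Rightarrow> 'x measure \<Rightarrow> ('w \<Rightarrow> 'x) \<Rightarrow> nat \<Rightarrow> (nat \<Rightarrow> nat \<Rightarrow> 'w \<Rightarrow> 'x) \<Rightarrow> bool" where
  "iid_copies M \<Xi> \<xi> B \<xi>s \<longleftrightarrow>
     prob_space.indep_vars M (\<lambda>_. \<Xi>) (\<lambda>(k, i). \<xi>s k i) (UNIV \<times> {1..B}) \<and>
     (\<forall>k. \<forall>i\<in>{1..B}. distr M \<Xi> (\<xi>s k i) = distr M \<Xi> \<xi>)"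

definition sample_algebra ::
  "'w measure \<Rightarrow> 'x measure \<Rightarrow> nat \<Rightarrow> (nat \<Rightarrow> nat \<Rightarrow> 'w \<Rightarrow> 'x) \<Rightarrow> nat \<Rightarrow> 'w measure" where
  "sample_algebra M \<Xi> B \<xi>s k =
     sigma (space M) {\<xi>s s i -` A \<inter> space M | s i A. s \<le> k \<and> i \<in> {1..B} \<and> A \<in> sets \<Xi>}"

definition batch_gradient ::
  "(real ^ 'n ^ 'm \<Rightarrow> 'x \<Rightarrow> real ^ 'n ^ 'm) \<Rightarrow> nat \<Rightarrow> (nat \<Rightarrow> nat \<Rightarrow> 'w \<Rightarrow> 'x) \<Rightarrow>
   (nat \<Rightarrow> 'w \<Rightarrow> real ^ 'n ^ 'm) \<Rightarrow> nat \<Rightarrow> 'w \<Rightarrow> real ^ 'n ^ 'm" where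
  "batch_gradient G B \<xi>s X k \<omega> = (1 / real B) *\<^sub>R (\<Sum>i = 1..B. G (X k \<omega>) (\<xi>s k i \<omega>))"

primrec momentum ::
  "(real ^ 'n ^ 'm \<Rightarrow> 'x \<Rightarrow> real ^ 'n ^ 'm) \<Rightarrow> nat \<Rightarrow> (nat \<Rightarrow> nat \<Rightarrow> 'w \<Rightarrow> 'x) \<Rightarrow> real \<Rightarrow>
   (nat \<Rightarrow> 'w \<Rightarrow> real ^ 'n ^ 'm) \<Rightarrow> nat \<Rightarrow> 'w \<Rightarrow> real ^ 'n ^ 'm" where
  "momentum G B \<xi>s \<theta> X 0 \<omega> = batch_gradient G B \<xi>s X 0 \<omega>"
| "momentum G B \<xi>s \<theta> X (Suc k) \<omega> =
     (1 - \<theta>) *\<^sub>R momentum G B \<xi>s \<theta> X k \<omega> + \<theta> *\<^sub>R batch_gradient G B \<xi>s X (Suc k) \<omega>"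

text \<open>
  \<open>X\<close> is a run, on the probability space \<open>M\<close>, of the method with regularization oracle. The
  minimizer in each step is an arbitrary one, subject only to measurability with respect to
  the samples drawn so far.
\<close>
definition Sp_Sq_run ::
  "'w measure \<Rightarrow> 'x measure \<Rightarrow> (real ^ 'n ^ 'm \<Rightarrow> 'x \<Rightarrow> real ^ 'n ^ 'm) \<Rightarrow>
   real ^ 'n ^ 'm \<Rightarrow> real \<Rightarrow> ereal \<Rightarrow> real \<Rightarrow> nat \<Rightarrow> (nat \<Rightarrow> nat \<Rightarrow> 'w \<Rightarrow> 'x) \<Rightarrow>
   (nat \<Rightarrow> 'w \<Rightarrow> real ^ 'n ^ 'm) \<Rightarrow> bool" where
  "Sp_Sq_run M \<Xi> G X\<^sub>0 \<theta> p \<eta> B \<xi>s X \<longleftrightarrow>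
     (\<forall>\<omega>\<in>space M. X 0 \<omega> = X\<^sub>0) \<and>
     (\<forall>k. \<forall>\<omega>\<in>space M.
        is_arg_min
          (\<lambda>Y. inner (momentum G B \<xi>s \<theta> X k \<omega>) (Y - X k \<omega>)
               + 1 / (2 * \<eta>) * (schatten_norm p (Y - X k \<omega>))\<^sup>2)
          (\<lambda>_. True) (X (Suc k) \<omega>)) \<and>
     (\<forall>k. X (Suc k) \<in> borel_measurable (sample_algebra M \<Xi> B \<xi>s k))"

end

theory Submission
  imports Defs
begin

text \<open>
  Write the momentum error \<open>M\<^sub>k - \<nabla>f(X\<^sub>k)\<close> as a drift, driven by the gradient increments
  \<open>\<nabla>f(X\<^sub>k) - \<nabla>f(X\<^sub>k\<^sub>+\<^sub>1)\<close>, plus an average of martingale differences. Smoothness and the optimality of the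
  step bound the drift by the past steps and give a descent inequality; these combine for every
  sample point into a bound of \<open>\<Sum>\<parallel>\<nabla>f(X\<^sub>k)\<parallel>\<^sup>2\<close> by \<open>L\<Delta>/\<theta>\<close> and the noise part alone, so no
  integrability of the iterates is needed. The noise part is handled by a quadratic majorant:
  for positive definite \<open>W\<close>, \<open>\<parallel>S\<parallel>\<^sub>q\<^sup>2\<close> is at most a constant times \<open>tr (S\<^sup>T W\<^sup>-\<^sup>1 S)\<close>. The
  cross terms of the martingale vanish in expectation, and the power \<open>W = (V V\<^sup>T + \<epsilon>)\<^sup>1\<^sup>-\<^sup>q\<^sup>/\<^sup>2\<close> with
  \<open>\<epsilon> \<rightarrow> 0\<close> turns the second moment bound into \<open>\<parallel>V\<parallel>\<^sub>q\<^sup>2\<close> without loss.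
\<close>

subsection \<open>Eigenbases and singular values\<close>

text \<open>For q < 2 the squared Schatten norm is not a quadratic form, so martingale differences
  are not orthogonal for it, and passing through the Frobenius norm would cost a dimension factor.
  The Loewner hypothesis controls exactly the moments of |u S|^2 for each fixed row vector u. These
  are quadratic, so noise is accumulated direction by direction, and the majorant recombines the
  directions only at the end, in the left singular vectors of V. The shift \<epsilon> is there
  because the weights carry the exponent q/2 - 1, negative for q < 2, while V may have zero singular
  values. The choice \<eta> = \<theta>/(4 L) makes one step move the gradient by at most \<theta>/4
  times the norm of the momentum. Hence the drift, in the l2 sense over time, is at most a quarter
  of the momentum and is absorbed by the decrease of f. Singular values are defined as roots of a
  characteristic polynomial. No norm property is visible in that form, so each of them is
  transported to an orthonormal eigenbasis of Z Z^T.\<close>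

text \<open>For small \<open>t\<close> with the sign of \<open>b\<close> the linear term dominates,
  and \<open>b / (\<bar>c\<bar> + 1)\<close> is small enough for every \<open>c\<close>. This is the
  first-order condition at a maximizer.\<close>

lemma quadratic_nonpos_imp_linear_zero:
  fixes b c :: real
  assumes "\<And>t. 2 * t * b + t\<^sup>2 * c \<le> 0"
  shows "b = 0"
proof (rule ccontr)
  assume "b \<noteq> 0"
  define t where "t = b / (\<bar>c\<bar> + 1)"
  have "2 * t * b + t\<^sup>2 * c = (b\<^sup>2 / (\<bar>c\<bar> + 1)\<^sup>2) * (2 * (\<bar>c\<bar> + 1) + c)"
  proof -
    have "c * b\<^sup>2 + 2 * b\<^sup>2 * (\<bar>c\<bar> + 1) = b\<^sup>2 * (2 * (\<bar>c\<bar> + 1) + c)" by algebra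
    moreover have "2 * t * b = 2 * b\<^sup>2 * (\<bar>c\<bar> + 1) / (\<bar>c\<bar> + 1)\<^sup>2"
      by (simp add: t_def power2_eq_square)
    moreover have "t\<^sup>2 * c = c * b\<^sup>2 / (\<bar>c\<bar> + 1)\<^sup>2"
      by (simp add: t_def power_divide)
    ultimately show ?thesis by (simp add: add_divide_distrib[symmetric] add.commute)
  qed
  moreover have "\<dots> > 0"
    using \<open>b \<noteq> 0\<close> by (intro mult_pos_pos divide_pos_pos) auto
  ultimately show False using assms[of t] by linarith
qed

text \<open>Take a maximizer \<open>x\<close> of the quadratic form on the unit sphere of
  \<open>S\<close>. Perturbing it inside \<open>S\<close> shows that the residual
  \<open>A *v x - l *\<^sub>R x\<close> is orthogonal to \<open>S\<close>; invariance puts the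
  residual in \<open>S\<close>, so it is zero.\<close>

lemma symmetric_eigenvector_in_subspace:
  fixes A :: "real ^ 'm ^ 'm"
  assumes sym: "transpose A = A" and S: "subspace S"
    and inv: "\<And>x. x \<in> S \<Longrightarrow> A *v x \<in> S" and nz: "S \<noteq> {0}"
  shows "\<exists>x l. x \<in> S \<and> norm x = 1 \<and> A *v x = l *\<^sub>R x"
proof -
  have symi: "inner x (A *v y) = inner (A *v x) y" for x y
    by (metis dot_lmul_matrix sym transpose_matrix_vector)
  define C where "C = S \<inter> sphere 0 1"
  have "compact C" unfolding C_def
    by (metis S closed_subspace compact_Int_closed compact_sphere inf_commute)
  moreover have "C \<noteq> {}"
  proof -
    obtain y where "y \<in> S" "y \<noteq> 0" using nz S subspace_0 by blast
    then have "(1 / norm y) *\<^sub>R y \<in> C"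
      using S by (auto simp: C_def subspace_scale)
    then show ?thesis by blast
  qed
  moreover have "continuous_on C (\<lambda>x. inner x (A *v x))"
    by (intro continuous_intros linear_continuous_on matrix_vector_mul_bounded_linear)
  ultimately obtain x where x: "x \<in> C" and max: "\<And>y. y \<in> C \<Longrightarrow> inner y (A *v y) \<le> inner x (A *v x)"
    using continuous_attains_sup by metis
  define l where "l = inner x (A *v x)"
  have xS: "x \<in> S" and nx: "norm x = 1" using x by (auto simp: C_def)
  have bound: "inner y (A *v y) \<le> l * inner y y" if "y \<in> S" for y
  proof (cases "y = 0")
    case False
    then have "(1 / norm y) *\<^sub>R y \<in> C"
      using that S by (auto simp: C_def subspace_scale)
    from max[OF this] have "inner y (A *v y) / (norm y)\<^sup>2 \<le> l"
      by (simp add: l_def matrix_vector_mult_scaleR power2_eq_square)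
    then show ?thesis using False by (simp add: divide_le_eq power2_norm_eq_inner)
  qed simp
  have orth: "inner y (A *v x - l *\<^sub>R x) = 0" if y: "y \<in> S" for y
  proof (rule quadratic_nonpos_imp_linear_zero)
    fix t :: real
    have "x + t *\<^sub>R y \<in> S" using xS y S by (simp add: subspace_add subspace_scale)
    from bound[OF this]
    have "inner x (A *v x) + t * inner x (A *v y) + (t * inner y (A *v x) + t * (t * inner y (A *v y)))
        \<le> l * (inner x x + t * inner x y + (t * inner y x + t * (t * inner y y)))"
      by (simp add: matrix_vector_mult_scaleR matrix_vector_right_distrib inner_add_left inner_add_right distrib_left)
    moreover have "inner x (A *v x) = l" "inner x x = 1" using nx by (auto simp: l_def norm_eq_1)
    moreover have "inner x (A *v y) = inner y (A *v x)"
      by (metis symi inner_commute)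
    moreover have "2 * t * (b - l * d) + t\<^sup>2 * (c - l * e) \<le> 0"
      if "l + t * b + (t * b + t * (t * c)) \<le> l * (1 + t * d + (t * d + t * (t * e)))" for b c d e :: real
    proof -
      have "2 * t * (b - l * d) + t\<^sup>2 * (c - l * e)
          = (l + t * b + (t * b + t * (t * c))) - l * (1 + t * d + (t * d + t * (t * e)))"
        by algebra
      with that show ?thesis by linarith
    qed
    ultimately have "2 * t * (inner y (A *v x) - l * inner y x)
        + t\<^sup>2 * (inner y (A *v y) - l * inner y y) \<le> 0"
      by (simp only: inner_commute[of x y])
    then show "2 * t * inner y (A *v x - l *\<^sub>R x)
        + t\<^sup>2 * (inner y (A *v y) - l * inner y y) \<le> 0"
      by (simp only: inner_diff_right inner_scaleR_right)
  qed
  have "A *v x - l *\<^sub>R x \<in> S"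
    using xS inv S by (simp add: subspace_diff subspace_scale)
  from orth[OF this] have "A *v x = l *\<^sub>R x" by simp
  with xS nx show ?thesis by blast
qed

text \<open>Split off one eigenvector \<open>x\<close>; symmetry of \<open>A\<close> keeps the
  orthogonal complement of \<open>x\<close> in \<open>S\<close> invariant, and its dimension is
  smaller by one.\<close>

lemma symmetric_eigenbasis_subspace:
  fixes A :: "real ^ 'm ^ 'm"
  assumes sym: "transpose A = A" and "subspace S" and "\<And>x. x \<in> S \<Longrightarrow> A *v x \<in> S"
  shows "\<exists>B. B \<subseteq> S \<and> finite B \<and> card B = dim S \<and> pairwise orthogonal B \<and>
    (\<forall>b\<in>B. norm b = 1 \<and> (\<exists>l. A *v b = l *\<^sub>R b))"
  using assms(2,3)
proof (induction "dim S" arbitrary: S rule: less_induct)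
  case less
  show ?case
  proof (cases "S = {0}")
    case True
    then show ?thesis by (intro exI[of _ "{}"]) (auto simp: dim_eq_0)
  next
    case False
    then obtain x l where x: "x \<in> S" "norm x = 1" "A *v x = l *\<^sub>R x"
      using symmetric_eigenvector_in_subspace[OF sym less.prems] by blast
    define T where "T = S \<inter> {y. inner x y = 0}"
    have T: "subspace T" unfolding T_def
      using less.prems(1) subspace_hyperplane by (rule subspace_inter)
    have xx: "inner x x = 1" using x by (simp add: norm_eq_1)
    have "x \<notin> T" by (simp add: T_def xx)
    have span: "span (insert x T) = S"
    proof (rule antisym)
      show "span (insert x T) \<subseteq> S"
        by (rule span_minimal) (use x less.prems in \<open>auto simp: T_def\<close>)
      show "S \<subseteq> span (insert x T)"
      proof
        fix y assume "y \<in> S"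
        then have "y - inner x y *\<^sub>R x \<in> T"
          using x less.prems xx by (simp add: T_def subspace_diff subspace_scale inner_diff_right)
        then have "inner x y *\<^sub>R x + (y - inner x y *\<^sub>R x) \<in> span (insert x T)"
          by (intro span_add span_scale span_base) auto
        then show "y \<in> span (insert x T)" by simp
      qed
    qed
    have "dim (insert x T) = dim T + 1"
      using \<open>x \<notin> T\<close> T by (metis dim_insert span_eq_iff)
    then have d: "dim S = dim T + 1" by (metis dim_span span)
    have "A *v y \<in> T" if "y \<in> T" for y
    proof -
      have "inner x (A *v y) = inner (A *v x) y"
        by (metis dot_lmul_matrix sym transpose_matrix_vector)
      then show ?thesis using that x less.prems(2) by (auto simp: T_def)
    qed
    then obtain B where B: "B \<subseteq> T" "finite B" "card B = dim T" "pairwise orthogonal B"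
      "\<forall>b\<in>B. norm b = 1 \<and> (\<exists>l. A *v b = l *\<^sub>R b)"
      using less.hyps[of T] T d by auto
    have "pairwise orthogonal (insert x B)"
      unfolding pairwise_insert using B by (auto simp: orthogonal_def T_def inner_commute)
    moreover have "x \<notin> B" using B \<open>x \<notin> T\<close> by blast
    ultimately show ?thesis using B x d
      by (intro exI[of _ "insert x B"]) (auto simp: T_def)
  qed
qed

definition orthonormal_family :: "('i \<Rightarrow> 'a::real_inner) \<Rightarrow> bool" where
  "orthonormal_family u \<longleftrightarrow> (\<forall>i j. inner (u i) (u j) = (if i = j then 1 else 0))"

lemma orthonormal_family_inner:
  "orthonormal_family u \<Longrightarrow> inner (u i) (u j) = (if i = j then 1 else 0)"
  by (simp add: orthonormal_family_def)

theorem symmetric_eigenbasis: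
  fixes A :: "real ^ 'm ^ 'm"
  assumes "transpose A = A"
  obtains u :: "'m \<Rightarrow> real ^ 'm" and l :: "'m \<Rightarrow> real"
  where "orthonormal_family u" "\<And>i. A *v u i = l i *\<^sub>R u i"
proof -
  obtain B where B: "finite B" "card B = CARD('m)" "pairwise orthogonal B"
    "\<forall>b\<in>B. norm b = 1 \<and> (\<exists>l. A *v b = l *\<^sub>R b)"
    using symmetric_eigenbasis_subspace[OF assms subspace_UNIV] by (auto simp: dim_UNIV)
  obtain u where u: "bij_betw u (UNIV :: 'm set) B"
    using B by (metis finite_class.finite_UNIV finite_same_card_bij)
  then have uB: "u i \<in> B" for i by (auto simp: bij_betw_def)
  then have "\<forall>i. \<exists>l. A *v u i = l *\<^sub>R u i" using B(4) by blast
  then obtain l where l: "\<And>i. A *v u i = l i *\<^sub>R u i" by metis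
  have "inner (u i) (u j) = (if i = j then 1 else 0)" for i j
  proof (cases "i = j")
    case True
    then show ?thesis using uB B by (simp add: norm_eq_1)
  next
    case False
    then have "u i \<noteq> u j" using u by (metis bij_betw_def injD)
    then show ?thesis using B(3) uB False by (auto simp: pairwise_def orthogonal_def)
  qed
  with l show ?thesis by (intro that[of u l]) (auto simp: orthonormal_family_def)
qed

text \<open>The vectors are the rows of a square matrix \<open>Q\<close>, and a right inverse of a
  square matrix is also a left inverse, so \<open>transpose Q ** Q = mat 1\<close>.\<close>

lemma orthonormal_family_expand:
  fixes u :: "'m \<Rightarrow> real ^ 'm"
  assumes u: "orthonormal_family u"
  shows "x = (\<Sum>i\<in>UNIV. inner (u i) x *\<^sub>R u i)"
proof -
  define Q :: "real ^ 'm ^ 'm" where "Q = (\<chi> i. u i)"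
  have "Q ** transpose Q = mat 1"
    using u by (auto simp: Q_def matrix_matrix_mult_def transpose_def mat_def vec_eq_iff
      orthonormal_family_def inner_vec_def)
  then have "transpose Q ** Q = mat 1" by (simp add: matrix_left_right_inverse)
  then have "x = transpose Q *v (Q *v x)" by (simp only: matrix_vector_mul_assoc matrix_vector_mul_lid)
  also have "\<dots> = (\<Sum>i\<in>UNIV. inner (u i) x *\<^sub>R u i)"
    by (simp add: vec_eq_iff Q_def matrix_vector_mult_def transpose_def inner_vec_def sum_component mult.commute)
  finally show ?thesis .
qed

lemma orthonormal_family_parseval:
  fixes u :: "'m \<Rightarrow> real ^ 'm"
  assumes u: "orthonormal_family u"
  shows "inner x y = (\<Sum>i\<in>UNIV. inner (u i) x * inner (u i) y)"
proof -
  have "inner x y = inner (\<Sum>i\<in>UNIV. inner (u i) x *\<^sub>R u i) y"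
    using orthonormal_family_expand[OF u] by metis
  then show ?thesis by (simp add: inner_sum_left)
qed

text \<open>Diagonalization over the ring of polynomials: the constant matrix \<open>Q\<close> of
  eigenvectors satisfies \<open>P ** transpose Q = transpose Q ** D\<close>. Taking determinants
  needs only that the determinants of \<open>Q\<close> and its transpose multiply to 1, so no
  polynomial is ever inverted.\<close>

lemma charpoly_eigenbasis:
  fixes A :: "real ^ 'm ^ 'm" and u :: "'m \<Rightarrow> real ^ 'm"
  assumes u: "orthonormal_family u" and l: "\<And>i. A *v u i = l i *\<^sub>R u i"
  shows "charpoly A = (\<Prod>i\<in>UNIV. [:- l i, 1:])"
proof -
  define P :: "real poly ^ 'm ^ 'm"
    where "P = (\<chi> i j. (if i = j then [:0, 1:] else 0) - [:A $ i $ j:])"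
  define Q :: "real poly ^ 'm ^ 'm" where "Q = (\<chi> i j. [:(u i) $ j:])"
  define D :: "real poly ^ 'm ^ 'm" where "D = (\<chi> i j. if i = j then [:- l i, 1:] else 0)"
  have const_sum: "(\<Sum>k\<in>UNIV. [:h k:]) = [:\<Sum>k\<in>UNIV. h k:]" for h :: "'m \<Rightarrow> real"
  proof -
    have "finite S \<Longrightarrow> (\<Sum>k\<in>S. [:h k:]) = [:\<Sum>k\<in>S. h k:]" for S
      by (induction S rule: finite_induct) auto
    then show ?thesis by simp
  qed
  have QQ: "Q ** transpose Q = mat 1"
  proof -
    have "(\<Sum>k\<in>UNIV. u i $ k * u j $ k) = (if i = j then 1 else 0)" for i j
      using u by (simp add: orthonormal_family_def inner_vec_def)
    then show ?thesis
      by (simp add: Q_def matrix_matrix_mult_def transpose_def mat_def vec_eq_iff const_sum pCons_one)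
  qed
  have PQ: "P ** transpose Q = transpose Q ** D"
  proof -
    have "(\<Sum>k\<in>UNIV. A $ i $ k * u j $ k) = l j * u j $ i" for i j
      using arg_cong[OF l[of j], of "\<lambda>x. x $ i"] by (simp add: matrix_vector_mult_def mult.commute)
    then have Au: "(\<Sum>k\<in>UNIV. [:A $ i $ k:] * [:(u j) $ k:]) = [:l j * u j $ i:]" for i j
      by (simp add: const_sum mult.commute)
    have "(\<Sum>k\<in>UNIV. ((if i = k then [:0, 1:] else 0) - [:A $ i $ k:]) * [:(u j) $ k:])
        = (\<Sum>k\<in>UNIV. [:(u k) $ i:] * (if k = j then [:- l k, 1:] else 0))" for i j
    proof -
      have "(\<Sum>k\<in>UNIV. ((if i = k then [:0, 1:] else 0) - [:A $ i $ k:]) * [:(u j) $ k:])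
          = (\<Sum>k\<in>UNIV. if i = k then [:0, 1:] * [:(u j) $ k:] else 0) - [:l j * u j $ i:]"
        unfolding Au[symmetric] sum_subtractf[symmetric] by (intro sum.cong) (auto simp: left_diff_distrib)
      also have "\<dots> = [:(u j) $ i:] * [:- l j, 1:]" by simp
      also have "\<dots> = (\<Sum>k\<in>UNIV. if k = j then [:(u k) $ i:] * [:- l k, 1:] else 0)" by simp
      also have "\<dots> = (\<Sum>k\<in>UNIV. [:(u k) $ i:] * (if k = j then [:- l k, 1:] else 0))"
        by (intro sum.cong) auto
      finally show ?thesis .
    qed
    then show ?thesis
      by (simp only: P_def Q_def D_def matrix_matrix_mult_def transpose_def vec_eq_iff vec_lambda_beta)
        blast
  qed
  have "det Q * det P * det (transpose Q) = det (Q ** transpose Q) * det D"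
  proof -
    have "det Q * det P * det (transpose Q) = det (Q ** (P ** transpose Q))"
      by (simp only: det_mul mult.assoc)
    also have "\<dots> = det (Q ** transpose Q ** D)"
      by (simp only: PQ matrix_mul_assoc)
    finally show ?thesis by (simp only: det_mul)
  qed
  moreover have "det Q * det (transpose Q) = 1"
    using arg_cong[OF QQ, of det] by (simp only: det_mul det_I)
  ultimately have "det P = det D"
    by (simp only: QQ det_I mult.commute[of "det Q" "det P"] mult.assoc mult_1_left mult_1_right)
  also have "\<dots> = (\<Prod>i\<in>UNIV. D $ i $ i)" by (rule det_diagonal) (simp add: D_def)
  finally show ?thesis by (simp add: charpoly_def P_def D_def)
qed

text \<open>
  The \<open>u i\<close> are left singular vectors; recording \<open>Z\<^sup>T u\<^sub>i = s\<^sub>i w\<^sub>i\<close> only through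
  Gram entries avoids choosing right singular vectors for zero singular values.
\<close>
definition singular_basis :: "real ^ 'n ^ 'm \<Rightarrow> ('m \<Rightarrow> real ^ 'm) \<Rightarrow> ('m \<Rightarrow> real) \<Rightarrow> bool" where
  "singular_basis Z u s \<longleftrightarrow> orthonormal_family u \<and> (\<forall>i. 0 \<le> s i) \<and>
     (\<forall>i j. inner (u i v* Z) (u j v* Z) = (if i = j then (s i)\<^sup>2 else 0))"

lemma inner_left_mult:
  fixes Z :: "real ^ 'n ^ 'm"
  shows "inner (x v* Z) (y v* Z) = inner x ((Z ** transpose Z) *v y)"
  by (simp add: dot_lmul_matrix flip: matrix_vector_mul_assoc)

lemma singular_basis_exists:
  fixes Z :: "real ^ 'n ^ 'm"
  obtains u s where "singular_basis Z u s"
proof -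
  have "transpose (Z ** transpose Z) = Z ** transpose Z"
    by (simp add: matrix_transpose_mul)
  then obtain u :: "'m \<Rightarrow> real ^ 'm" and l where u: "orthonormal_family u" and l: "\<And>i. (Z ** transpose Z) *v u i = l i *\<^sub>R u i"
    using symmetric_eigenbasis by blast
  have g: "inner (u i v* Z) (u j v* Z) = (if i = j then l i else 0)" for i j
    using u by (simp add: inner_left_mult l orthonormal_family_def)
  have "0 \<le> l i" for i using g[of i i] by (metis inner_ge_zero)
  then have "singular_basis Z u (\<lambda>i. sqrt (l i))"
    using u g by (simp add: singular_basis_def)
  then show ?thesis using that by blast
qed

text \<open>The Gram relations make each \<open>u i\<close> an eigenvector of
  \<open>Z ** transpose Z\<close> with eigenvalue the square of \<open>s i\<close>. This is the
  bridge from the definition by polynomial roots: every norm may be computed in whichever singular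
  basis is at hand.\<close>

lemma singular_values_singular_basis:
  fixes Z :: "real ^ 'n ^ 'm"
  assumes "singular_basis Z u s"
  shows "singular_values Z = image_mset s (mset_set UNIV)"
proof -
  have u: "orthonormal_family u" and s: "\<And>i. 0 \<le> s i"
    and g: "\<And>i j. inner (u i v* Z) (u j v* Z) = (if i = j then (s i)\<^sup>2 else 0)"
    using assms by (auto simp: singular_basis_def)
  have "(Z ** transpose Z) *v u i = (s i)\<^sup>2 *\<^sub>R u i" for i
  proof -
    have "(Z ** transpose Z) *v u i = (\<Sum>j\<in>UNIV. inner (u j) ((Z ** transpose Z) *v u i) *\<^sub>R u j)"
      by (rule orthonormal_family_expand[OF u])
    also have "\<dots> = (\<Sum>j\<in>UNIV. (if j = i then (s i)\<^sup>2 *\<^sub>R u i else 0))"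
      by (intro sum.cong) (auto simp: g simp flip: inner_left_mult)
    finally show ?thesis by simp
  qed
  then have "charpoly (Z ** transpose Z) = (\<Prod>i\<in>UNIV. [:- (s i)\<^sup>2, 1:])"
    by (rule charpoly_eigenbasis[OF u])
  then have "proots (charpoly (Z ** transpose Z)) = (\<Sum>i\<in>UNIV. {#(s i)\<^sup>2#})"
    by (simp add: proots_prod)
  also have "\<dots> = image_mset (\<lambda>i. (s i)\<^sup>2) (mset_set UNIV)"
    by (simp add: sum_unfold_sum_mset)
  finally show ?thesis
    using s by (simp add: singular_values_def image_mset.compositionality o_def real_sqrt_abs)
qed

lemma schatten_norm_finite:
  assumes "singular_basis Z u s" and "r \<noteq> \<infinity>"
  shows "schatten_norm r Z = (\<Sum>i\<in>UNIV. s i powr real_of_ereal r) powr (1 / real_of_ereal r)"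
  using assms by (simp add: schatten_norm_def singular_values_singular_basis
    image_mset.compositionality o_def sum_unfold_sum_mset)

lemma schatten_norm_infinity:
  assumes "singular_basis Z u s"
  shows "schatten_norm \<infinity> Z = Max (range s)"
  using assms by (simp add: schatten_norm_def singular_values_singular_basis)

subsection \<open>Duality of Schatten norms\<close>

lemma schatten_norm_nonneg: "0 \<le> schatten_norm r (Z :: real ^ 'n ^ 'm)"
proof -
  obtain u s where s: "singular_basis Z u s" by (rule singular_basis_exists)
  show ?thesis
  proof (cases "r = \<infinity>")
    case True
    have "0 \<le> s undefined" using s by (simp add: singular_basis_def)
    also have "\<dots> \<le> Max (range s)" by simp
    finally show ?thesis using True by (simp add: schatten_norm_infinity[OF s])
  next
    case False
    then show ?thesis by (simp add: schatten_norm_finite[OF s])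
  qed
qed

lemma singular_basis_scaleR:
  fixes Z :: "real ^ 'n ^ 'm"
  assumes "singular_basis Z u s"
  shows "singular_basis (c *\<^sub>R Z) u (\<lambda>i. \<bar>c\<bar> * s i)"
proof -
  have "x v* (c *\<^sub>R Z) = c *\<^sub>R (x v* Z)" for x
    by (simp add: vec_eq_iff vector_matrix_mult_def sum_distrib_left mult_ac)
  then show ?thesis
    using assms by (auto simp: singular_basis_def power_mult_distrib power2_eq_square)
qed

lemma schatten_norm_scaleR:
  fixes Z :: "real ^ 'n ^ 'm"
  assumes "1 \<le> r"
  shows "schatten_norm r (c *\<^sub>R Z) = \<bar>c\<bar> * schatten_norm r Z"
proof -
  obtain u s where s: "singular_basis Z u s" by (rule singular_basis_exists)
  note cs = singular_basis_scaleR[OF s, of c]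
  have s0: "0 \<le> s i" for i using s by (simp add: singular_basis_def)
  show ?thesis
  proof (cases "r = \<infinity>")
    case True
    have "range (\<lambda>i. \<bar>c\<bar> * s i) = (\<lambda>x. \<bar>c\<bar> * x) ` range s" by auto
    moreover have "Max ((\<lambda>x. \<bar>c\<bar> * x) ` range s) = \<bar>c\<bar> * Max (range s)"
      by (rule mono_Max_commute[symmetric]) (auto simp: mono_def mult_left_mono)
    ultimately show ?thesis
      by (simp add: True schatten_norm_infinity[OF s] schatten_norm_infinity[OF cs])
  next
    case False
    then obtain a where a: "r = ereal a" "1 \<le> a"
      using assms by (cases r) auto
    have "(\<Sum>i\<in>UNIV. (\<bar>c\<bar> * s i) powr a) = \<bar>c\<bar> powr a * (\<Sum>i\<in>UNIV. s i powr a)"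
      using s0 by (simp add: powr_mult sum_distrib_left)
    then show ?thesis using a s0
      by (simp add: schatten_norm_finite[OF s] schatten_norm_finite[OF cs] powr_mult powr_powr sum_nonneg)
  qed
qed

section \<open>The trace pairing of two matrices expressed through singular bases\<close>

lemma inner_matrix_orthonormal:
  fixes A B :: "real ^ 'n ^ 'm" and u :: "'m \<Rightarrow> real ^ 'm"
  assumes u: "orthonormal_family u"
  shows "inner A B = (\<Sum>i\<in>UNIV. inner (u i v* A) (u i v* B))"
proof -
  have col: "(x v* Z) $ c = inner x (column c Z)" for x c and Z :: "real ^ 'n ^ 'm"
    by (simp add: vector_matrix_mult_def column_def inner_vec_def mult.commute)
  have "inner A B = (\<Sum>i\<in>UNIV. \<Sum>c\<in>UNIV. A $ i $ c * B $ i $ c)"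
    by (simp add: inner_vec_def)
  also have "\<dots> = (\<Sum>c\<in>UNIV. \<Sum>i\<in>UNIV. A $ i $ c * B $ i $ c)"
    by (rule sum.swap)
  also have "\<dots> = (\<Sum>c\<in>UNIV. inner (column c A) (column c B))"
    by (simp add: inner_vec_def column_def)
  also have "\<dots> = (\<Sum>c\<in>UNIV. \<Sum>i\<in>UNIV. (u i v* A) $ c * (u i v* B) $ c)"
    by (subst orthonormal_family_parseval[OF u]) (simp only: col)
  also have "\<dots> = (\<Sum>i\<in>UNIV. inner (u i v* A) (u i v* B))"
    by (subst sum.swap) (simp add: inner_vec_def)
  finally show ?thesis .
qed

lemma left_mult_expand:
  fixes B :: "real ^ 'n ^ 'm" and v :: "'m \<Rightarrow> real ^ 'm"
  assumes v: "orthonormal_family v"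
  shows "x v* B = (\<Sum>j\<in>UNIV. inner (v j) x *\<^sub>R (v j v* B))"
proof -
  have "linear (\<lambda>x. transpose B *v x)" by (rule matrix_vector_mul_linear)
  then have lin: "linear (\<lambda>x. x v* B)" by simp
  have "x v* B = (\<Sum>j\<in>UNIV. inner (v j) x *\<^sub>R v j) v* B"
    using orthonormal_family_expand[OF v, of x] by simp
  also have "\<dots> = (\<Sum>j\<in>UNIV. inner (v j) x *\<^sub>R (v j v* B))"
    by (simp only: linear_sum[OF lin] linear_scale[OF lin])
  finally show ?thesis .
qed

lemma norm_left_mult_expand:
  fixes S :: "real ^ 'n ^ 'm"
  assumes S: "singular_basis S v s"
  shows "(norm (x v* S))\<^sup>2 = (\<Sum>j\<in>UNIV. (inner (v j) x)\<^sup>2 * (s j)\<^sup>2)"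
proof -
  have v: "orthonormal_family v"
    and g: "\<And>i j. inner (v i v* S) (v j v* S) = (if i = j then (s i)\<^sup>2 else 0)"
    using S by (auto simp: singular_basis_def)
  have "(norm (x v* S))\<^sup>2 = inner (\<Sum>j\<in>UNIV. inner (v j) x *\<^sub>R (v j v* S)) (\<Sum>j\<in>UNIV. inner (v j) x *\<^sub>R (v j v* S))"
    unfolding power2_norm_eq_inner by (simp only: left_mult_expand[OF v, of x S, symmetric])
  also have "\<dots> = (\<Sum>j\<in>UNIV. (inner (v j) x)\<^sup>2 * (s j)\<^sup>2)"
    by (simp add: inner_sum_left inner_sum_right g if_distrib power2_eq_square mult.assoc cong: if_cong)
  finally show ?thesis .
qed

lemma Bessel_inequality:
  fixes z :: "'i::finite \<Rightarrow> 'a::real_inner"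
  assumes orth: "\<And>i j. i \<noteq> j \<Longrightarrow> inner (z i) (z j) = 0" and le1: "\<And>i. inner (z i) (z i) \<le> 1"
  shows "(\<Sum>i\<in>UNIV. (inner x (z i))\<^sup>2) \<le> inner x x"
proof -
  define y where "y = (\<Sum>i\<in>UNIV. inner x (z i) *\<^sub>R z i)"
  have yy: "inner y y \<le> (\<Sum>i\<in>UNIV. (inner x (z i))\<^sup>2)"
  proof -
    have "inner (z i) y = inner x (z i) * inner (z i) (z i)" for i
    proof -
      have "inner (z i) y = (\<Sum>j\<in>UNIV. if j = i then inner x (z i) * inner (z i) (z i) else 0)"
        unfolding y_def inner_sum_right by (intro sum.cong refl) (auto simp: orth)
      then show ?thesis by simp
    qed
    then have "inner y y = (\<Sum>i\<in>UNIV. (inner x (z i))\<^sup>2 * inner (z i) (z i))"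
      by (subst (1) y_def) (simp add: inner_sum_left power2_eq_square mult.assoc)
    also have "\<dots> \<le> (\<Sum>i\<in>UNIV. (inner x (z i))\<^sup>2)"
      using le1 by (simp add: sum_mono mult_left_le)
    finally show ?thesis .
  qed
  moreover have "inner x y = (\<Sum>i\<in>UNIV. (inner x (z i))\<^sup>2)"
    by (simp add: y_def inner_sum_right power2_eq_square)
  moreover have "0 \<le> inner (x - y) (x - y)" by simp
  then have "0 \<le> inner x x - 2 * inner x y + inner y y"
    by (simp add: inner_diff_left inner_diff_right inner_commute)
  ultimately show ?thesis by linarith
qed

text \<open>After normalizing both sequences, Young's inequality splits each product; the row sums
  then absorb the terms in \<open>a\<close> and the column sums the terms in
  \<open>b\<close>.\<close>

lemma Holder_substochastic:
  fixes a :: "'i::finite \<Rightarrow> real" and b :: "'j::finite \<Rightarrow> real"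
  assumes c0: "\<And>i j. 0 \<le> c i j" and row: "\<And>i. (\<Sum>j\<in>UNIV. c i j) \<le> 1" and col: "\<And>j. (\<Sum>i\<in>UNIV. c i j) \<le> 1"
    and a0: "\<And>i. 0 \<le> a i" and b0: "\<And>j. 0 \<le> b j"
    and p: "1 < p" and q: "1 < q" and pq: "1 / p + 1 / q = 1"
  shows "(\<Sum>i\<in>UNIV. \<Sum>j\<in>UNIV. c i j * (a i * b j))
    \<le> (\<Sum>i\<in>UNIV. a i powr q) powr (1 / q) * (\<Sum>j\<in>UNIV. b j powr p) powr (1 / p)"
proof -
  define \<alpha> where "\<alpha> = (\<Sum>i\<in>UNIV. a i powr q) powr (1 / q)"
  define \<beta> where "\<beta> = (\<Sum>j\<in>UNIV. b j powr p) powr (1 / p)"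
  show ?thesis
  proof (cases "\<alpha> = 0 \<or> \<beta> = 0")
    case True
    then have "(\<forall>i. a i = 0) \<or> (\<forall>j. b j = 0)"
      by (auto simp: \<alpha>_def \<beta>_def sum_nonneg_eq_0_iff)
    then have "(\<Sum>i\<in>UNIV. \<Sum>j\<in>UNIV. c i j * (a i * b j)) = 0" by auto
    then show ?thesis by simp
  next
    case False
    then have pos: "0 < \<alpha>" "0 < \<beta>" by (auto simp: \<alpha>_def \<beta>_def)
    have nrm: "(\<Sum>i\<in>UNIV. (a i / \<alpha>) powr q) = 1" "(\<Sum>j\<in>UNIV. (b j / \<beta>) powr p) = 1"
    proof -
      have "\<alpha> powr q = (\<Sum>i\<in>UNIV. a i powr q)" "\<beta> powr p = (\<Sum>j\<in>UNIV. b j powr p)"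
        using p q by (auto simp: \<alpha>_def \<beta>_def powr_powr sum_nonneg)
      then show "(\<Sum>i\<in>UNIV. (a i / \<alpha>) powr q) = 1" "(\<Sum>j\<in>UNIV. (b j / \<beta>) powr p) = 1"
        using a0 b0 pos by (auto simp: powr_divide simp flip: sum_divide_distrib)
    qed
    have "(\<Sum>i\<in>UNIV. \<Sum>j\<in>UNIV. c i j * (a i * b j)) / (\<alpha> * \<beta>)
        = (\<Sum>i\<in>UNIV. \<Sum>j\<in>UNIV. c i j * ((a i / \<alpha>) * (b j / \<beta>)))"
      by (simp add: sum_divide_distrib)
    also have "\<dots> \<le> (\<Sum>i\<in>UNIV. \<Sum>j\<in>UNIV. c i j * ((a i / \<alpha>) powr q / q + (b j / \<beta>) powr p / p))"
      using p q pq c0 a0 b0 pos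
      by (intro sum_mono mult_left_mono Youngs_inequality) (auto simp: add.commute)
    also have "\<dots> = (\<Sum>i\<in>UNIV. (\<Sum>j\<in>UNIV. c i j) * ((a i / \<alpha>) powr q / q))
        + (\<Sum>j\<in>UNIV. (\<Sum>i\<in>UNIV. c i j) * ((b j / \<beta>) powr p / p))"
    proof -
      have "(\<Sum>i\<in>UNIV. \<Sum>j\<in>UNIV. c i j * ((b j / \<beta>) powr p / p))
          = (\<Sum>j\<in>UNIV. \<Sum>i\<in>UNIV. c i j * ((b j / \<beta>) powr p / p))"
        by (rule sum.swap)
      then show ?thesis by (simp only: distrib_left sum.distrib sum_distrib_right)
    qed
    also have "\<dots> \<le> (\<Sum>i\<in>UNIV. (a i / \<alpha>) powr q / q) + (\<Sum>j\<in>UNIV. (b j / \<beta>) powr p / p)"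
      using p q row col c0 by (intro add_mono sum_mono mult_left_le_one_le) (auto simp: sum_nonneg)
    also have "\<dots> = 1" using pq nrm by (simp flip: sum_divide_distrib)
    finally have "(\<Sum>i\<in>UNIV. \<Sum>j\<in>UNIV. c i j * (a i * b j)) \<le> \<alpha> * \<beta>"
      using pos by (simp add: divide_le_eq)
    then show ?thesis by (simp add: \<alpha>_def \<beta>_def)
  qed
qed

text \<open>Real exponents with the endpoint listed apart replace an identity between extended
  reals. Only \<open>p\<close> can be infinite here, so \<open>q\<close> is always a finite
  exponent.\<close>

definition conjugate_exponents :: "ereal \<Rightarrow> ereal \<Rightarrow> bool" where
  "conjugate_exponents p q \<longleftrightarrow> p = \<infinity> \<and> q = 1 \<or>
     (\<exists>a b. p = ereal a \<and> q = ereal b \<and> 1 < a \<and> 1 < b \<and> 1 / a + 1 / b = 1)"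

text \<open>Expanding both matrices gives the coefficients
  \<open>inner (u i) (v j) * inner (w i) (z j)\<close>, with overlaps of left and of right singular
  vectors. The mean of the two squares dominates this product, and Bessel bounds its row and column
  sums.\<close>

lemma inner_singular_bases_le:
  fixes A B :: "real ^ 'n ^ 'm"
  assumes A: "singular_basis A u a" and B: "singular_basis B v b"
  obtains c :: "'m \<Rightarrow> 'm \<Rightarrow> real"
  where "\<And>i j. 0 \<le> c i j" "\<And>i. (\<Sum>j\<in>UNIV. c i j) \<le> 1" "\<And>j. (\<Sum>i\<in>UNIV. c i j) \<le> 1"
    and "inner A B \<le> (\<Sum>i\<in>UNIV. \<Sum>j\<in>UNIV. c i j * (a i * b j))"
proof -
  have u: "orthonormal_family u" and v: "orthonormal_family v"
    and a0: "\<And>i. 0 \<le> a i" and b0: "\<And>i. 0 \<le> b i"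
    and gA: "\<And>i j. inner (u i v* A) (u j v* A) = (if i = j then (a i)\<^sup>2 else 0)"
    and gB: "\<And>i j. inner (v i v* B) (v j v* B) = (if i = j then (b i)\<^sup>2 else 0)"
    using A B by (auto simp: singular_basis_def)
  \<comment> \<open>Since \<open>1 / 0 = 0\<close>, a zero singular value yields the zero vector,
    and \<open>uw\<close> and \<open>vz\<close> hold in that case too.\<close>
  define w :: "'m \<Rightarrow> real ^ 'n" where "w i = (1 / a i) *\<^sub>R (u i v* A)" for i
  define z :: "'m \<Rightarrow> real ^ 'n" where "z j = (1 / b j) *\<^sub>R (v j v* B)" for j
  have uw: "u i v* A = a i *\<^sub>R w i" for i
    using gA[of i i] by (cases "a i = 0") (auto simp: w_def)
  have vz: "v j v* B = b j *\<^sub>R z j" for j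
    using gB[of j j] by (cases "b j = 0") (auto simp: z_def)
  have w: "inner (w i) (w j) = 0" if "i \<noteq> j" for i j using that by (simp add: w_def gA)
  have w1: "inner (w i) (w i) \<le> 1" for i by (simp add: w_def gA power2_eq_square)
  have z: "inner (z i) (z j) = 0" if "i \<noteq> j" for i j using that by (simp add: z_def gB)
  have z1: "inner (z i) (z i) \<le> 1" for i by (simp add: z_def gB power2_eq_square)
  define c where "c i j = ((inner (u i) (v j))\<^sup>2 + (inner (w i) (z j))\<^sup>2) / 2" for i j
  have "(\<Sum>j\<in>UNIV. c i j) \<le> 1" for i
  proof -
    have "(\<Sum>j\<in>UNIV. (inner (u i) (v j))\<^sup>2) \<le> 1"
      using Bessel_inequality[of v, where x = "u i"] u v by (simp add: orthonormal_family_def)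
    moreover have "(\<Sum>j\<in>UNIV. (inner (w i) (z j))\<^sup>2) \<le> 1"
      using Bessel_inequality[of z, OF z z1, where x = "w i"] w1[of i] by simp
    ultimately show ?thesis by (simp add: c_def sum.distrib flip: sum_divide_distrib)
  qed
  moreover have "(\<Sum>i\<in>UNIV. c i j) \<le> 1" for j
  proof -
    have "(\<Sum>i\<in>UNIV. (inner (u i) (v j))\<^sup>2) \<le> 1"
      using Bessel_inequality[of u, where x = "v j"] u v by (simp add: orthonormal_family_def inner_commute)
    moreover have "(\<Sum>i\<in>UNIV. (inner (w i) (z j))\<^sup>2) \<le> 1"
      using Bessel_inequality[of w, OF w w1, where x = "z j"] z1[of j] by (simp add: inner_commute)
    ultimately show ?thesis by (simp add: c_def sum.distrib flip: sum_divide_distrib)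
  qed
  moreover have "inner A B \<le> (\<Sum>i\<in>UNIV. \<Sum>j\<in>UNIV. c i j * (a i * b j))"
  proof -
    have "inner A B = (\<Sum>i\<in>UNIV. inner (a i *\<^sub>R w i) (\<Sum>j\<in>UNIV. inner (v j) (u i) *\<^sub>R (b j *\<^sub>R z j)))"
    proof -
      have uB: "u i v* B = (\<Sum>j\<in>UNIV. inner (v j) (u i) *\<^sub>R (b j *\<^sub>R z j))" for i
        unfolding vz[symmetric] by (rule left_mult_expand[OF v])
      show ?thesis by (simp only: inner_matrix_orthonormal[OF u] uw uB)
    qed
    also have "\<dots> = (\<Sum>i\<in>UNIV. \<Sum>j\<in>UNIV. (inner (u i) (v j) * inner (w i) (z j)) * (a i * b j))"
      by (simp add: inner_sum_right sum_distrib_left inner_commute[of "v _" "u _"] mult_ac)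
    also have "\<dots> \<le> (\<Sum>i\<in>UNIV. \<Sum>j\<in>UNIV. c i j * (a i * b j))"
    proof (intro sum_mono mult_right_mono)
      fix i j
      show "inner (u i) (v j) * inner (w i) (z j) \<le> c i j"
        using sum_squares_bound[of "inner (u i) (v j)" "inner (w i) (z j)"] by (simp add: c_def)
    qed (use a0 b0 in auto)
    finally show ?thesis .
  qed
  ultimately show ?thesis by (intro that[of c]) (auto simp: c_def)
qed

text \<open>The overlap coefficients reduce the matrix inequality to a scalar one. At the endpoint
  the largest singular value of \<open>B\<close> is pulled out and the row sums suffice.\<close>

theorem schatten_Holder:
  fixes A B :: "real ^ 'n ^ 'm"
  assumes "conjugate_exponents p q"
  shows "inner A B \<le> schatten_norm q A * schatten_norm p B"
proof -
  obtain u a where A: "singular_basis A u a" by (rule singular_basis_exists)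
  obtain v b where B: "singular_basis B v b" by (rule singular_basis_exists)
  obtain c :: "'m \<Rightarrow> 'm \<Rightarrow> real"
    where c0: "\<And>i j. 0 \<le> c i j" and row: "\<And>i. (\<Sum>j\<in>UNIV. c i j) \<le> 1"
      and col: "\<And>j. (\<Sum>i\<in>UNIV. c i j) \<le> 1"
      and le: "inner A B \<le> (\<Sum>i\<in>UNIV. \<Sum>j\<in>UNIV. c i j * (a i * b j))"
    using inner_singular_bases_le[OF A B] by blast
  have a0: "\<And>i. 0 \<le> a i" and b0: "\<And>i. 0 \<le> b i"
    using A B by (auto simp: singular_basis_def)
  from assms consider "p = \<infinity>" "q = 1"
    | p' q' where "p = ereal p'" "q = ereal q'" "1 < p'" "1 < q'" "1 / p' + 1 / q' = 1"
    unfolding conjugate_exponents_def by blast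
  then show ?thesis
  proof cases
    case 1
    define m where "m = Max (range b)"
    have m: "b j \<le> m" for j by (simp add: m_def)
    then have m0: "0 \<le> m" using b0 order_trans by blast
    have "(\<Sum>i\<in>UNIV. \<Sum>j\<in>UNIV. c i j * (a i * b j)) \<le> (\<Sum>i\<in>UNIV. \<Sum>j\<in>UNIV. c i j * (a i * m))"
      using c0 a0 m by (intro sum_mono mult_left_mono) auto
    also have "\<dots> = (\<Sum>i\<in>UNIV. (\<Sum>j\<in>UNIV. c i j) * (a i * m))"
      by (simp add: sum_distrib_right)
    also have "\<dots> \<le> (\<Sum>i\<in>UNIV. a i * m)"
      using row c0 a0 m0 by (intro sum_mono mult_left_le_one_le) (auto simp: sum_nonneg)
    also have "\<dots> = schatten_norm q A * schatten_norm p B"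
      using a0 by (simp add: 1 schatten_norm_infinity[OF B] schatten_norm_finite[OF A] m_def
        sum_nonneg flip: sum_distrib_right)
    finally show ?thesis using le by linarith
  next
    case 2
    then show ?thesis
      using le Holder_substochastic[of c a b, OF c0 row col a0 b0 2(3,4,5)]
      by (simp add: schatten_norm_finite[OF B] schatten_norm_finite[OF A])
  qed
qed

text \<open>Left multiplication by the matrix \<open>R\<close> with eigenvectors \<open>u i\<close>
  and eigenvalues \<open>d i / a i\<close> changes the singular values without naming right singular
  vectors. Where \<open>a i = 0\<close> the row \<open>u i v* A\<close> vanishes and cannot be
  rescaled, hence the condition \<open>ad\<close>.\<close>

lemma singular_basis_rescale:
  fixes A :: "real ^ 'n ^ 'm"
  assumes A: "singular_basis A u a" and d0: "\<And>i. 0 \<le> d i" and ad: "\<And>i. a i = 0 \<Longrightarrow> d i = 0"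
  obtains D where "singular_basis D u d" "inner A D = (\<Sum>i\<in>UNIV. a i * d i)"
proof -
  have u: "orthonormal_family u" and a0: "\<And>i. 0 \<le> a i"
    and gA: "\<And>i j. inner (u i v* A) (u j v* A) = (if i = j then (a i)\<^sup>2 else 0)"
    using A by (auto simp: singular_basis_def)
  define R :: "real ^ 'm ^ 'm" where "R = (\<chi> r s. \<Sum>i\<in>UNIV. d i / a i * (u i $ r * u i $ s))"
  define D where "D = R ** A"
  have uR: "u j v* R = (d j / a j) *\<^sub>R u j" for j
  proof -
    have "(u j v* R) $ s = (d j / a j) * u j $ s" for s
    proof -
      have "(u j v* R) $ s = (\<Sum>r\<in>UNIV. \<Sum>i\<in>UNIV. d i / a i * u i $ s * (u i $ r * u j $ r))"
        by (simp add: R_def vector_matrix_mult_def sum_distrib_right sum_distrib_left mult_ac)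
      also have "\<dots> = (\<Sum>i\<in>UNIV. d i / a i * u i $ s * inner (u i) (u j))"
        by (subst sum.swap) (simp add: inner_vec_def sum_distrib_left)
      also have "\<dots> = (d j / a j) * u j $ s"
        by (simp add: orthonormal_family_inner[OF u] if_distrib cong: if_cong)
      finally show ?thesis .
    qed
    then show ?thesis by (simp add: vec_eq_iff)
  qed
  have uD: "u j v* D = (d j / a j) *\<^sub>R (u j v* A)" for j
    unfolding D_def vector_matrix_mul_assoc[symmetric] uR
    by (simp add: vec_eq_iff vector_matrix_mult_def sum_distrib_left mult_ac)
  have "singular_basis D u d"
    using u d0 ad by (auto simp: singular_basis_def uD gA power2_eq_square)
  moreover have "inner A D = (\<Sum>i\<in>UNIV. a i * d i)"
    using ad by (auto simp: inner_matrix_orthonormal[OF u] uD gA power2_eq_square intro!: sum.cong)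
  ultimately show ?thesis using that by blast
qed

text \<open>The extremal matrix shares the singular vectors of \<open>A\<close> and has the singular
  values for which the scalar Hoelder inequality is an equality; at the endpoint it is a partial
  isometry.\<close>

theorem schatten_dual_attained:
  fixes A :: "real ^ 'n ^ 'm"
  assumes "conjugate_exponents p q"
  obtains D where "schatten_norm p D \<le> 1" "inner A D = schatten_norm q A"
proof -
  obtain u a where A: "singular_basis A u a" by (rule singular_basis_exists)
  have a0: "\<And>i. 0 \<le> a i" using A by (auto simp: singular_basis_def)
  from assms consider "p = \<infinity>" "q = 1"
    | p' q' where "p = ereal p'" "q = ereal q'" "1 < p'" "1 < q'" "1 / p' + 1 / q' = 1"
    unfolding conjugate_exponents_def by blast
  then show ?thesis
  proof cases
    case 1
    define d where "d i = (if a i = 0 then 0 else 1 :: real)" for i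
    obtain D where D: "singular_basis D u d" "inner A D = (\<Sum>i\<in>UNIV. a i * d i)"
      by (rule singular_basis_rescale[OF A, of d]) (auto simp: d_def)
    have "schatten_norm p D \<le> 1"
      by (simp add: 1 schatten_norm_infinity[OF D(1)]) (auto simp: d_def)
    moreover have "inner A D = schatten_norm q A"
      using a0 by (simp add: 1 schatten_norm_finite[OF A] D sum_nonneg) (auto simp: d_def intro!: sum.cong)
    ultimately show ?thesis using that by blast
  next
    case 2
    define \<alpha> where "\<alpha> = schatten_norm q A"
    have \<alpha>: "\<alpha> = (\<Sum>i\<in>UNIV. a i powr q') powr (1 / q')"
      using 2 by (simp add: \<alpha>_def schatten_norm_finite[OF A])
    have \<alpha>0: "0 \<le> \<alpha>" by (simp add: \<alpha>_def schatten_norm_nonneg)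
    \<comment> \<open>For \<open>\<alpha> = 0\<close> the quotient is 0, so all \<open>d i\<close>
      vanish and the same definition covers this case.\<close>
    define d where "d i = (a i / \<alpha>) powr (q' - 1)" for i
    obtain D where D: "singular_basis D u d" "inner A D = (\<Sum>i\<in>UNIV. a i * d i)"
      by (rule singular_basis_rescale[OF A, of d]) (auto simp: d_def)
    have \<alpha>q: "\<alpha> powr q' = (\<Sum>i\<in>UNIV. a i powr q')"
      using 2 by (simp add: \<alpha> powr_powr sum_nonneg)
    have sum: "(\<Sum>i\<in>UNIV. (a i / \<alpha>) powr q') = (if \<alpha> = 0 then 0 else 1)"
      using a0 \<alpha>0 by (simp add: powr_divide \<alpha>q[symmetric] flip: sum_divide_distrib)
    have "(q' - 1) * p' = q'"
      using 2 by (simp add: field_simps)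
    then have "(\<Sum>i\<in>UNIV. d i powr p') = (\<Sum>i\<in>UNIV. (a i / \<alpha>) powr q')"
      by (simp add: d_def powr_powr)
    then have "schatten_norm p D \<le> 1"
      using 2 by (simp add: schatten_norm_finite[OF D(1)] sum)
    moreover have "inner A D = \<alpha>"
    proof (cases "\<alpha> = 0")
      case True
      then show ?thesis by (simp add: D d_def)
    next
      case False
      have "a i * d i = \<alpha> * (a i / \<alpha>) powr q'" for i
        using a0[of i] \<alpha>0 False 2
        by (cases "a i = 0") (auto simp: d_def powr_diff)
      then show ?thesis using False by (simp add: D sum flip: sum_distrib_left)
    qed
    ultimately show ?thesis using that by (simp add: \<alpha>_def)
  qed
qed

text \<open>One dual matrix of \<open>A + B\<close> is tested against both summands.\<close>

lemma schatten_norm_triangle: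
  fixes A B :: "real ^ 'n ^ 'm"
  assumes "conjugate_exponents p q"
  shows "schatten_norm q (A + B) \<le> schatten_norm q A + schatten_norm q B"
proof -
  obtain D where D: "schatten_norm p D \<le> 1" "inner (A + B) D = schatten_norm q (A + B)"
    by (rule schatten_dual_attained[OF assms])
  have "inner Z D \<le> schatten_norm q Z" for Z
    using schatten_Holder[OF assms, of Z D] mult_left_mono[OF D(1) schatten_norm_nonneg[of q Z]] by simp
  from this[of A] this[of B] show ?thesis using D by (simp add: inner_add_left)
qed

section \<open>Continuity of the Schatten norm and its quadratic majorant\<close>

lemma schatten_norm_le_norm:
  fixes A :: "real ^ 'n ^ 'm"
  assumes "0 < q"
  shows "schatten_norm (ereal q) A \<le> real CARD('m) powr (1 / q) * norm A"
proof -
  obtain u a where A: "singular_basis A u a" by (rule singular_basis_exists)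
  have u: "orthonormal_family u" and a0: "\<And>i. 0 \<le> a i"
    and gA: "\<And>i j. inner (u i v* A) (u j v* A) = (if i = j then (a i)\<^sup>2 else 0)"
    using A by (auto simp: singular_basis_def)
  have "a i \<le> norm A" for i
  proof -
    have "(a i)\<^sup>2 \<le> (\<Sum>i\<in>UNIV. (a i)\<^sup>2)" by (rule member_le_sum) auto
    also have "\<dots> = (norm A)\<^sup>2"
      by (simp add: power2_norm_eq_inner inner_matrix_orthonormal[OF u] gA)
    finally show ?thesis by (simp add: power2_le_iff_abs_le)
  qed
  then have "(\<Sum>i\<in>UNIV. a i powr q) \<le> (\<Sum>i\<in>(UNIV::'m set). norm A powr q)"
    using a0 assms by (intro sum_mono powr_mono2) auto
  then have "(\<Sum>i\<in>UNIV. a i powr q) powr (1 / q) \<le> (real CARD('m) * norm A powr q) powr (1 / q)"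
    using assms by (intro powr_mono2) (auto simp: sum_nonneg)
  then show ?thesis using assms
    by (simp add: schatten_norm_finite[OF A] powr_mult powr_powr)
qed

text \<open>Needed for measurability of the norms of random matrices; the dimension factor in the
  Lipschitz constant therefore never reaches the final bound.\<close>

lemma continuous_on_schatten_norm:
  assumes pq: "conjugate_exponents p q"
  shows "continuous_on UNIV (schatten_norm q :: real ^ 'n ^ 'm \<Rightarrow> real)"
proof -
  obtain b where b: "q = ereal b" "1 \<le> b"
    using pq by (auto simp: conjugate_exponents_def one_ereal_def)
  define C where "C = real CARD('m) powr (1 / b)"
  have lip: "schatten_norm q Y \<le> schatten_norm q Z + C * norm (Y - Z)" for Y Z :: "real ^ 'n ^ 'm"
    using schatten_norm_triangle[OF pq, of Z "Y - Z"] schatten_norm_le_norm[of b "Y - Z"] b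
    by (simp add: C_def)
  have "C-lipschitz_on UNIV (schatten_norm q :: real ^ 'n ^ 'm \<Rightarrow> real)"
  proof (rule lipschitz_onI)
    fix Y Z :: "real ^ 'n ^ 'm"
    show "dist (schatten_norm q Y) (schatten_norm q Z) \<le> C * dist Y Z"
      using lip[of Y Z] lip[of Z Y] by (simp add: dist_norm norm_minus_commute abs_le_iff)
  qed (simp add: C_def)
  then show ?thesis by (rule lipschitz_on_continuous_on)
qed

text \<open>Weighted Young inequality with exponents \<open>q / 2\<close> and
  \<open>1 - q / 2\<close>, averaged over the doubly stochastic matrix of squared overlaps between
  \<open>u\<close> and the singular basis of \<open>S\<close>. There is equality when
  \<open>u\<close> consists of left singular vectors of \<open>S\<close> and the
  \<open>\<tau> i\<close> are its squared singular values, so no dimension factor enters.\<close>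

lemma schatten_norm_quadratic_majorant:
  fixes S :: "real ^ 'n ^ 'm" and u :: "'m \<Rightarrow> real ^ 'm"
  assumes u: "orthonormal_family u" and \<tau>: "\<And>i. 0 < \<tau> i" and q: "0 < q" "q \<le> 2"
  shows "(schatten_norm (ereal q) S)\<^sup>2 \<le>
    (\<Sum>i\<in>UNIV. \<tau> i powr (q / 2)) powr (2 / q - 1) * (\<Sum>i\<in>UNIV. \<tau> i powr (q / 2 - 1) * (norm (u i v* S))\<^sup>2)"
proof -
  obtain v s where S: "singular_basis S v s" by (rule singular_basis_exists)
  have v: "orthonormal_family v" and s0: "\<And>i. 0 \<le> s i"
    and gS: "\<And>i j. inner (v i v* S) (v j v* S) = (if i = j then (s i)\<^sup>2 else 0)"
    using S by (auto simp: singular_basis_def)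
  define T where "T = (\<Sum>i\<in>UNIV. \<tau> i powr (q / 2))"
  define Y where "Y = (\<Sum>i\<in>UNIV. \<tau> i powr (q / 2 - 1) * (norm (u i v* S))\<^sup>2)"
  define c where "c i j = (inner (u i) (v j))\<^sup>2" for i j
  have row: "(\<Sum>j\<in>UNIV. c i j) = 1" for i
    using orthonormal_family_parseval[OF v, of "u i" "u i"] u
    by (simp add: c_def orthonormal_family_def inner_commute power2_eq_square)
  have col: "(\<Sum>i\<in>UNIV. c i j) = 1" for j
    using orthonormal_family_parseval[OF u, of "v j" "v j"] v
    by (simp add: c_def orthonormal_family_def power2_eq_square)
  have T: "0 < T" unfolding T_def using \<tau> by (intro sum_pos) (auto simp: less_imp_neq[THEN not_sym])
  have Y0: "0 \<le> Y" unfolding Y_def by (intro sum_nonneg) auto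
  have "(\<Sum>j\<in>UNIV. s j powr q) powr (2 / q) \<le> T powr (2 / q - 1) * Y"
  proof (cases "Y = 0")
    case True
    have "norm (u i v* S) = 0" for i
    proof -
      have "\<tau> i powr (q / 2 - 1) * (norm (u i v* S))\<^sup>2 = 0"
        using True unfolding Y_def by (subst (asm) sum_nonneg_eq_0_iff) auto
      then show ?thesis using \<tau>[of i] by simp
    qed
    then have "inner S S = 0" by (simp add: inner_matrix_orthonormal[OF u])
    then have "S = 0" by simp
    then have "s j = 0" for j using gS[of j j] by simp
    then show ?thesis using True by simp
  next
    case False
    \<comment> \<open>The scale that balances the two Young terms: with it
      \<open>\<mu> powr (q / 2 - 1) * Y\<close> equals
      \<open>\<mu> powr (q / 2) * T\<close>.\<close>
    define \<mu> where "\<mu> = Y / T"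
    have \<mu>: "0 < \<mu>" using False Y0 T by (simp add: \<mu>_def)
    have young: "s j powr q \<le> q / 2 * (\<mu> powr (q / 2 - 1) * (\<tau> i powr (q / 2 - 1) * (s j)\<^sup>2))
        + (1 - q / 2) * (\<mu> powr (q / 2) * \<tau> i powr (q / 2))" for i j
    proof (cases "s j = 0")
      case False
      then have sj: "0 < s j" using s0[of j] by simp
      define t where "t = \<mu> * \<tau> i"
      have t: "0 < t" using \<mu> \<tau> by (simp add: t_def)
      have "s j powr q = (t powr (q / 2 - 1) * (s j)\<^sup>2) powr (q / 2) * (t powr (q / 2)) powr (1 - q / 2)"
      proof -
        have "(s j)\<^sup>2 powr (q / 2) = s j powr q"
          using sj powr_powr[of "s j" 2 "q / 2"] by simp
        moreover have "(q / 2 - 1) * (q / 2) + q / 2 * (1 - q / 2) = 0"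
          by (simp add: algebra_simps)
        then have "(t powr (q / 2 - 1)) powr (q / 2) * (t powr (q / 2)) powr (1 - q / 2) = 1"
          using t by (simp add: powr_powr flip: powr_add)
        ultimately show ?thesis by (simp add: powr_mult)
      qed
      also have "\<dots> \<le> q / 2 * (t powr (q / 2 - 1) * (s j)\<^sup>2) + (1 - q / 2) * t powr (q / 2)"
        using q t sj by (intro Youngs_inequality_0) auto
      finally show ?thesis using \<mu> \<tau>[of i] by (simp add: t_def powr_mult)
    qed (use q in auto)
    have "(\<Sum>j\<in>UNIV. s j powr q) = (\<Sum>j\<in>UNIV. \<Sum>i\<in>UNIV. c i j * s j powr q)"
      by (simp add: col flip: sum_distrib_right)
    also have "\<dots> \<le> (\<Sum>j\<in>UNIV. \<Sum>i\<in>UNIV. c i j * (q / 2 * (\<mu> powr (q / 2 - 1) * (\<tau> i powr (q / 2 - 1) * (s j)\<^sup>2))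
        + (1 - q / 2) * (\<mu> powr (q / 2) * \<tau> i powr (q / 2))))"
      by (intro sum_mono mult_left_mono young) (simp add: c_def)
    also have "\<dots> = q / 2 * (\<mu> powr (q / 2 - 1) * (\<Sum>i\<in>UNIV. \<Sum>j\<in>UNIV. \<tau> i powr (q / 2 - 1) * (c i j * (s j)\<^sup>2)))
        + (1 - q / 2) * (\<mu> powr (q / 2) * (\<Sum>i\<in>UNIV. (\<Sum>j\<in>UNIV. c i j) * \<tau> i powr (q / 2)))"
      by (subst sum.swap) (simp add: distrib_left sum.distrib sum_distrib_left sum_distrib_right mult_ac)
    also have "(\<Sum>i\<in>UNIV. \<Sum>j\<in>UNIV. \<tau> i powr (q / 2 - 1) * (c i j * (s j)\<^sup>2)) = Y"
      by (simp add: Y_def norm_left_mult_expand[OF S] c_def sum_distrib_left inner_commute)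
    also have "(\<Sum>i\<in>UNIV. (\<Sum>j\<in>UNIV. c i j) * \<tau> i powr (q / 2)) = T"
      by (simp add: row T_def)
    also have "q / 2 * (\<mu> powr (q / 2 - 1) * Y) + (1 - q / 2) * (\<mu> powr (q / 2) * T) = \<mu> powr (q / 2) * T"
    proof -
      have "\<mu> powr (q / 2 - 1) * Y = \<mu> powr (q / 2) * T"
        using \<mu> T Y0 False by (simp add: powr_diff \<mu>_def)
      then show ?thesis by (simp add: algebra_simps)
    qed
    finally have "(\<Sum>j\<in>UNIV. s j powr q) powr (2 / q) \<le> (\<mu> powr (q / 2) * T) powr (2 / q)"
      using q by (intro powr_mono2) (auto simp: sum_nonneg)
    also have "\<dots> = T powr (2 / q - 1) * Y"
      using q \<mu> T by (simp add: powr_mult powr_powr powr_diff) (simp add: \<mu>_def)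
    finally show ?thesis .
  qed
  moreover have "(schatten_norm (ereal q) S)\<^sup>2 = (\<Sum>j\<in>UNIV. s j powr q) powr (2 / q)"
    using powr_powr[of "\<Sum>j\<in>UNIV. s j powr q" "1 / q" 2]
    by (simp add: schatten_norm_finite[OF S] powr_realpow' sum_nonneg)
  ultimately show ?thesis by (simp add: T_def Y_def)
qed

subsection \<open>Descent and momentum recursion\<close>

text \<open>Along the segment, \<open>f\<close> minus its quadratic upper model is the function
  \<open>\<phi>\<close>. Its derivative is nonpositive by Hoelder and the Lipschitz condition, so
  comparing the endpoints replaces integrating the gradient.\<close>

lemma descent_inequality:
  fixes f :: "real ^ 'n ^ 'm \<Rightarrow> real"
  assumes grad: "\<And>Y. GDERIV f Y :> gradf Y" and pq: "conjugate_exponents p q" and p1: "1 \<le> p"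
    and smooth: "\<And>Y Z. schatten_norm q (gradf Z - gradf Y) \<le> L * schatten_norm p (Z - Y)"
  shows "f (X + D) \<le> f X + inner (gradf X) D + L / 2 * (schatten_norm p D)\<^sup>2"
proof -
  define N where "N = schatten_norm p D"
  have N0: "0 \<le> N" by (simp add: N_def schatten_norm_nonneg)
  define \<phi> where "\<phi> t = f (X + t *\<^sub>R D) - t * inner (gradf X) D - L / 2 * (t\<^sup>2 * N\<^sup>2)" for t
  have "\<phi> 1 \<le> \<phi> 0"
  proof (rule DERIV_nonpos_imp_nonincreasing[of 0 1 \<phi>])
    fix t :: real assume t: "0 \<le> t"
    have "((\<lambda>t. f (X + t *\<^sub>R D)) has_derivative (\<lambda>h. inner (h *\<^sub>R D) (gradf (X + t *\<^sub>R D)))) (at t)"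
    proof (rule has_derivative_compose[where g = f])
      show "((\<lambda>t. X + t *\<^sub>R D) has_derivative (\<lambda>h. h *\<^sub>R D)) (at t)"
        by (auto intro!: derivative_eq_intros)
      show "(f has_derivative (\<lambda>h. inner h (gradf (X + t *\<^sub>R D)))) (at (X + t *\<^sub>R D))"
        using grad by (simp add: gderiv_def)
    qed
    then have "((\<lambda>t. f (X + t *\<^sub>R D)) has_real_derivative inner (gradf (X + t *\<^sub>R D)) D) (at t)"
      by (simp add: has_field_derivative_def inner_commute mult_commute_abs)
    then have "(\<phi> has_real_derivative (inner (gradf (X + t *\<^sub>R D)) D - inner (gradf X) D - L * (t * N\<^sup>2))) (at t)"
      unfolding \<phi>_def by (auto intro!: derivative_eq_intros)
    moreover have "inner (gradf (X + t *\<^sub>R D)) D - inner (gradf X) D \<le> L * (t * N\<^sup>2)"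
    proof -
      have "inner (gradf (X + t *\<^sub>R D) - gradf X) D \<le> schatten_norm q (gradf (X + t *\<^sub>R D) - gradf X) * N"
        unfolding N_def by (rule schatten_Holder[OF pq])
      also have "\<dots> \<le> (L * schatten_norm p (t *\<^sub>R D)) * N"
        using smooth[of "X + t *\<^sub>R D" X] N0 by (intro mult_right_mono) auto
      also have "\<dots> = L * (t * N\<^sup>2)"
        using t by (simp add: schatten_norm_scaleR[OF p1] N_def power2_eq_square)
      finally show ?thesis by (simp add: inner_diff_left)
    qed
    ultimately show "\<exists>y. (\<phi> has_real_derivative y) (at t) \<and> y \<le> 0"
      by (metis diff_le_0_iff_le)
  qed simp
  then show ?thesis by (simp add: \<phi>_def N_def)
qed

text \<open>A competitor along a dual direction of \<open>G\<close> bounds the optimal value above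
  by \<open>- \<eta> / 2 * ?m\<^sup>2\<close>, and Hoelder bounds it below. The two differ by a
  perfect square, which forces \<open>?N = \<eta> * ?m\<close>. The argument applies to every
  minimizer, so the selection does not matter.\<close>

lemma regularized_step:
  fixes G X X' :: "real ^ 'n ^ 'm"
  assumes pq: "conjugate_exponents p q" and p1: "1 \<le> p" and \<eta>: "0 < \<eta>"
    and min: "is_arg_min (\<lambda>Y. inner G (Y - X) + 1 / (2 * \<eta>) * (schatten_norm p (Y - X))\<^sup>2) (\<lambda>_. True) X'"
  shows "schatten_norm p (X' - X) = \<eta> * schatten_norm q G" (is "?N = \<eta> * ?m")
    and "inner G (X' - X) \<le> - \<eta> * (schatten_norm q G)\<^sup>2"
proof -
  obtain D where D: "schatten_norm p D \<le> 1" "inner G D = ?m"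
    by (rule schatten_dual_attained[OF pq])
  have m0: "0 \<le> ?m" and N0: "0 \<le> ?N" by (auto simp: schatten_norm_nonneg)
  have "inner G (X' - X) + 1 / (2 * \<eta>) * ?N\<^sup>2
      \<le> inner G ((- \<eta> * ?m) *\<^sub>R D) + 1 / (2 * \<eta>) * (schatten_norm p ((- \<eta> * ?m) *\<^sub>R D))\<^sup>2"
    using min[unfolded is_arg_min_linorder] by (metis add_diff_cancel_left')
  also have "\<dots> \<le> - \<eta> * ?m\<^sup>2 + 1 / (2 * \<eta>) * (\<eta> * ?m)\<^sup>2"
  proof -
    have "schatten_norm p ((- \<eta> * ?m) *\<^sub>R D) \<le> \<eta> * ?m"
      unfolding schatten_norm_scaleR[OF p1] using D(1) \<eta> m0 by (simp add: abs_mult mult_left_le)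
    then have "(schatten_norm p ((- \<eta> * ?m) *\<^sub>R D))\<^sup>2 \<le> (\<eta> * ?m)\<^sup>2"
      by (intro power_mono schatten_norm_nonneg)
    then have "1 / (2 * \<eta>) * (schatten_norm p ((- \<eta> * ?m) *\<^sub>R D))\<^sup>2 \<le> 1 / (2 * \<eta>) * (\<eta> * ?m)\<^sup>2"
      using \<eta> by (intro mult_left_mono) auto
    then show ?thesis by (simp add: D(2) power2_eq_square mult.assoc)
  qed
  also have "\<dots> = - \<eta> / 2 * ?m\<^sup>2"
    using \<eta> by (simp add: field_simps power2_eq_square)
  finally have up: "inner G (X' - X) + 1 / (2 * \<eta>) * ?N\<^sup>2 \<le> - \<eta> / 2 * ?m\<^sup>2" .
  have "inner (- G) (X' - X) \<le> schatten_norm q (- G) * ?N"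
    by (rule schatten_Holder[OF pq])
  moreover have "schatten_norm q (- G) = ?m"
    using schatten_norm_scaleR[of q "-1" G] pq by (auto simp: conjugate_exponents_def)
  ultimately have low: "- ?m * ?N \<le> inner G (X' - X)" by simp
  have "(?N - \<eta> * ?m)\<^sup>2 = 2 * \<eta> * (- ?m * ?N + 1 / (2 * \<eta>) * ?N\<^sup>2 + \<eta> / 2 * ?m\<^sup>2)"
    using \<eta> by (simp add: power2_eq_square field_simps)
  also have "\<dots> \<le> 0" using up low \<eta> by (intro mult_nonneg_nonpos) auto
  finally show N: "?N = \<eta> * ?m" by simp
  show "inner G (X' - X) \<le> - \<eta> * ?m\<^sup>2"
    using up \<eta> by (simp add: N power2_eq_square field_simps)
qed

section \<open>Scalar recursions and the passage from directional moments to Schatten norms\<close>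

lemma convex_square:
  fixes a b \<theta> :: real
  assumes "0 \<le> \<theta>" "\<theta> \<le> 1"
  shows "((1 - \<theta>) * a + \<theta> * b)\<^sup>2 \<le> (1 - \<theta>) * a\<^sup>2 + \<theta> * b\<^sup>2"
proof -
  have "(1 - \<theta>) * a\<^sup>2 + \<theta> * b\<^sup>2 - ((1 - \<theta>) * a + \<theta> * b)\<^sup>2 = \<theta> * (1 - \<theta>) * (a - b)\<^sup>2"
    by algebra
  moreover have "\<dots> \<ge> 0" using assms by simp
  ultimately show ?thesis by linarith
qed

text \<open>The deterministic core in scalars: \<open>F\<close> stands for function values,
  \<open>g\<close> for gradient norms, \<open>m\<close> for momentum norms, \<open>e\<close> for
  momentum errors, \<open>d\<close> for their drift part and \<open>s\<close> for their noise part.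
  The drift is charged to \<open>m\<close> and \<open>m\<close> to the decrease of \<open>F\<close>,
  so only the initial gap and the noise remain.\<close>

lemma momentum_recursion_bound:
  fixes F m e d s g :: "nat \<Rightarrow> real"
  assumes \<theta>: "0 < \<theta>" "\<theta> \<le> 1" and L: "0 < L" and \<eta>: "\<eta> = \<theta> / (4 * L)"
    and pos: "\<And>k. 0 \<le> m k" "\<And>k. 0 \<le> e k" "\<And>k. 0 \<le> d k" "\<And>k. 0 \<le> s k" "\<And>k. 0 \<le> g k"
    and F: "\<And>k. F (Suc k) \<le> F k - \<eta> * (m k)\<^sup>2 + e k * (\<eta> * m k) + L / 2 * (\<eta> * m k)\<^sup>2"
    and low: "\<And>k. F_low \<le> F k"
    and e: "\<And>k. e k \<le> d k + s k" and g: "\<And>k. g k \<le> m k + e k"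
    and d: "d 0 = 0" "\<And>k. d (Suc k) \<le> (1 - \<theta>) * (d k + L * (\<eta> * m k))"
  shows "(\<Sum>k<K. (g k)\<^sup>2) \<le> 144 / 5 * (L * (F 0 - F_low) / \<theta>) + 56 / 5 * (\<Sum>k<K. (s k)\<^sup>2)"
proof -
  define X where "X = L * (F 0 - F_low) / \<theta>"
  have L\<eta>: "L * \<eta> = \<theta> / 4" and \<eta>0: "0 < \<eta>" using L \<theta> by (auto simp: \<eta>)
  \<comment> \<open>Convexity keeps the contraction factor \<open>1 - \<theta>\<close>; splitting
    the square with factors 2 would destroy it for small \<open>\<theta>\<close>. The 16 comes from
    \<open>L * \<eta> = \<theta> / 4\<close>.\<close>
  have d_step: "(d (Suc k))\<^sup>2 \<le> (1 - \<theta>) * (d k)\<^sup>2 + \<theta> * ((m k)\<^sup>2 / 16)" for k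
  proof -
    have "d (Suc k) \<le> (1 - \<theta>) * d k + (1 - \<theta>) * (\<theta> * (m k / 4))"
      using d(2)[of k] by (simp add: distrib_left L\<eta> flip: mult.assoc)
    also have "\<dots> \<le> (1 - \<theta>) * d k + \<theta> * (m k / 4)"
      using \<theta> pos(1)[of k] by (intro add_left_mono mult_left_le_one_le) auto
    finally have "(d (Suc k))\<^sup>2 \<le> ((1 - \<theta>) * d k + \<theta> * (m k / 4))\<^sup>2"
      using pos(3) by (intro power_mono)
    also have "\<dots> \<le> (1 - \<theta>) * (d k)\<^sup>2 + \<theta> * (m k / 4)\<^sup>2"
      using \<theta> by (intro convex_square) auto
    finally show ?thesis by (simp add: power_divide)
  qed
  \<comment> \<open>The last drift term is kept on the left to make the induction telescope; it is
    dropped afterwards.\<close>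
  have "\<theta> * (\<Sum>k<n. (d k)\<^sup>2) + (d n)\<^sup>2 \<le> \<theta> * ((\<Sum>k<n. (m k)\<^sup>2) / 16)" for n
  proof (induction n)
    case 0
    then show ?case by (simp add: d)
  next
    case (Suc n)
    then show ?case using d_step[of n] by (simp add: algebra_simps add_divide_distrib)
  qed
  from this[of K] have "\<theta> * (\<Sum>k<K. (d k)\<^sup>2) \<le> \<theta> * ((\<Sum>k<K. (m k)\<^sup>2) / 16)"
    using zero_le_power2[of "d K"] by linarith
  then have sum_d: "(\<Sum>k<K. (d k)\<^sup>2) \<le> (\<Sum>k<K. (m k)\<^sup>2) / 16"
    using \<theta> by (simp only: mult_le_cancel_left_pos)
  have e2: "(e k)\<^sup>2 \<le> 2 * (d k)\<^sup>2 + 2 * (s k)\<^sup>2" for k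
  proof -
    have "(e k)\<^sup>2 \<le> (d k + s k)\<^sup>2" using e pos by (intro power_mono)
    also have "\<dots> \<le> 2 * (d k)\<^sup>2 + 2 * (s k)\<^sup>2"
      using sum_squares_bound[of "d k" "s k"] by (simp add: power2_sum)
    finally show ?thesis .
  qed
  \<comment> \<open>From the coefficient 1 of the decrease, \<open>e k * m k\<close> takes 1/2 and
    the curvature term 1/8, which leaves 3/8.\<close>
  have F_step: "\<eta> * (3 / 8 * (m k)\<^sup>2 - (d k)\<^sup>2 - (s k)\<^sup>2) \<le> F k - F (Suc k)" for k
  proof -
    have "L / 2 * (\<eta> * m k)\<^sup>2 = \<eta> * (\<theta> / 8 * (m k)\<^sup>2)"
      using L\<eta> by (simp add: power2_eq_square)
    also have "\<dots> \<le> \<eta> * (1 / 8 * (m k)\<^sup>2)"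
      using \<theta> \<eta>0 by (intro mult_left_mono mult_right_mono) auto
    finally have 1: "L / 2 * (\<eta> * m k)\<^sup>2 \<le> \<eta> * (1 / 8 * (m k)\<^sup>2)" .
    have "e k * m k \<le> (e k)\<^sup>2 / 2 + (m k)\<^sup>2 / 2"
      using sum_squares_bound[of "e k" "m k"] by simp
    also have "\<dots> \<le> (m k)\<^sup>2 / 2 + (d k)\<^sup>2 + (s k)\<^sup>2" using e2[of k] by simp
    finally have "\<eta> * (e k * m k) \<le> \<eta> * ((m k)\<^sup>2 / 2 + (d k)\<^sup>2 + (s k)\<^sup>2)"
      using \<eta>0 by simp
    with 1 F[of k] show ?thesis by (simp add: algebra_simps)
  qed
  have "(\<Sum>k<K. \<eta> * (3 / 8 * (m k)\<^sup>2 - (d k)\<^sup>2 - (s k)\<^sup>2)) \<le> (\<Sum>k<K. F k - F (Suc k))"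
    by (intro sum_mono F_step)
  also have "\<dots> = F 0 - F K" by (rule sum_lessThan_telescope')
  also have "\<dots> \<le> F 0 - F_low" using low by simp
  finally have "\<eta> * (\<Sum>k<K. 3 / 8 * (m k)\<^sup>2 - (d k)\<^sup>2 - (s k)\<^sup>2) \<le> F 0 - F_low"
    by (simp add: sum_distrib_left)
  then have "(\<Sum>k<K. 3 / 8 * (m k)\<^sup>2 - (d k)\<^sup>2 - (s k)\<^sup>2) \<le> (F 0 - F_low) / \<eta>"
    using \<eta>0 by (simp add: pos_le_divide_eq mult.commute)
  also have "(F 0 - F_low) / \<eta> = 4 * X" by (simp add: \<eta> X_def)
  finally have "3 / 8 * (\<Sum>k<K. (m k)\<^sup>2) - (\<Sum>k<K. (d k)\<^sup>2) - (\<Sum>k<K. (s k)\<^sup>2)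
      \<le> 4 * X"
    by (simp add: sum_subtractf sum_distrib_left)
  then have sum_m: "5 / 16 * (\<Sum>k<K. (m k)\<^sup>2) \<le> 4 * X + (\<Sum>k<K. (s k)\<^sup>2)"
    using sum_d by linarith
  have "(g k)\<^sup>2 \<le> 2 * (m k)\<^sup>2 + 4 * (d k)\<^sup>2 + 4 * (s k)\<^sup>2" for k
  proof -
    have "(g k)\<^sup>2 \<le> (m k + e k)\<^sup>2" using g pos by (intro power_mono)
    also have "\<dots> \<le> 2 * (m k)\<^sup>2 + 2 * (e k)\<^sup>2"
      using sum_squares_bound[of "m k" "e k"] by (simp add: power2_sum)
    finally show ?thesis using e2[of k] by linarith
  qed
  then have "(\<Sum>k<K. (g k)\<^sup>2) \<le> (\<Sum>k<K. 2 * (m k)\<^sup>2 + 4 * (d k)\<^sup>2 + 4 * (s k)\<^sup>2)"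
    by (rule sum_mono)
  also have "\<dots> = 2 * (\<Sum>k<K. (m k)\<^sup>2) + 4 * (\<Sum>k<K. (d k)\<^sup>2) + 4 * (\<Sum>k<K. (s k)\<^sup>2)"
    by (simp add: sum.distrib sum_distrib_left)
  \<comment> \<open>By \<open>sum_d\<close> the right side is at most 9/4 of the momentum sum plus 4
    times the noise sum. By \<open>sum_m\<close> the momentum sum is at most 16/5 of
    \<open>4 * X\<close> plus the noise sum, which gives 36/5 * 4 = 144/5 and 36/5 + 4 =
    56/5.\<close>
  finally have "(\<Sum>k<K. (g k)\<^sup>2) \<le> 144 / 5 * X + 56 / 5 * (\<Sum>k<K. (s k)\<^sup>2)"
    using sum_m sum_d by linarith
  then show ?thesis by (simp only: X_def)
qed

text \<open>The variance of an exponentially weighted average of uncorrelated unit noises, started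
  at the first noise with full weight.\<close>

primrec noise_weight :: "real \<Rightarrow> nat \<Rightarrow> real" where
  "noise_weight \<theta> 0 = 1"
| "noise_weight \<theta> (Suc k) = (1 - \<theta>)\<^sup>2 * noise_weight \<theta> k + \<theta>\<^sup>2"

lemma noise_weight_nonneg: "0 \<le> noise_weight \<theta> k"
  by (induction k) auto

text \<open>As \<open>(1 - \<theta>)\<^sup>2 \<le> 1 - \<theta>\<close>, each step removes at least
  the fraction \<open>\<theta>\<close> of the weight and adds \<open>\<theta>\<^sup>2\<close>. The
  term \<open>1 / \<theta>\<close> pays for the initial weight 1.\<close>

lemma sum_noise_weight_le:
  assumes \<theta>: "0 < \<theta>" "\<theta> \<le> 1"
  shows "(\<Sum>k<K. noise_weight \<theta> k) \<le> \<theta> * real K + 1 / \<theta>"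
proof -
  have "\<theta> * (\<Sum>k<n. noise_weight \<theta> k) + noise_weight \<theta> n \<le> \<theta>\<^sup>2 * real n + 1" for n
  proof (induction n)
    case (Suc n)
    have "(1 - \<theta>)\<^sup>2 * noise_weight \<theta> n \<le> (1 - \<theta>) * noise_weight \<theta> n"
      using \<theta> noise_weight_nonneg[of \<theta> n]
      by (intro mult_right_mono) (auto simp: power2_eq_square mult_left_le)
    with Suc show ?case by (simp add: algebra_simps)
  qed simp
  from this[of K] have "\<theta> * (\<Sum>k<K. noise_weight \<theta> k) \<le> \<theta>\<^sup>2 * real K + 1"
    using noise_weight_nonneg[of \<theta> K] by linarith
  also have "\<dots> = \<theta> * (\<theta> * real K + 1 / \<theta>)"
    using \<theta> by (simp add: power2_eq_square distrib_left)
  finally show ?thesis using \<theta> by (simp only: mult_le_cancel_left_pos)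
qed

text \<open>With \<open>\<rho>\<close> the untruncated parameter, \<open>A / K\<close> is
  \<open>\<sigma>\<^sup>2 * \<rho>\<^sup>2\<close> and the square root is
  \<open>\<sigma>\<^sup>2 * \<rho>\<close>, so all claims become elementary in
  \<open>\<theta> = min \<rho> 1\<close>. The two summands of the last bound are the two cases of
  the minimum.\<close>

lemma stepsize_tradeoff:
  fixes A \<sigma> \<theta> K :: real
  assumes A: "\<sigma>\<^sup>2 \<le> A" and K: "0 < K"
    and \<theta>: "\<theta> = (if \<sigma> = 0 then 1 else min (sqrt (A / (\<sigma>\<^sup>2 * K))) 1)"
  shows "0 < \<theta>" "\<theta> \<le> 1" "\<sigma>\<^sup>2 * \<theta> \<le> sqrt (\<sigma>\<^sup>2 * A / K)"
    and "A / (\<theta> * K) \<le> sqrt (\<sigma>\<^sup>2 * A / K) + A / K"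
proof -
  have A0: "0 \<le> A" using A zero_le_power2[of \<sigma>] by linarith
  have "0 < \<theta> \<and> \<theta> \<le> 1 \<and> \<sigma>\<^sup>2 * \<theta> \<le> sqrt (\<sigma>\<^sup>2 * A / K) \<and> A / (\<theta> * K) \<le> sqrt (\<sigma>\<^sup>2 * A / K) + A / K"
  proof (cases "\<sigma> = 0")
    case True
    then show ?thesis using A0 K by (simp add: \<theta>)
  next
    case False
    then have s2: "0 < \<sigma>\<^sup>2" by simp
    define \<rho> where "\<rho> = sqrt (A / (\<sigma>\<^sup>2 * K))"
    have "0 < A" using s2 A by linarith
    then have \<rho>: "0 < \<rho>" using s2 K by (simp add: \<rho>_def)
    have "\<rho>\<^sup>2 = A / (\<sigma>\<^sup>2 * K)" using A0 K by (simp add: \<rho>_def)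
    then have AK: "A / K = \<sigma>\<^sup>2 * \<rho>\<^sup>2" using s2 K by (simp add: field_simps)
    have "\<sigma>\<^sup>2 * A / K = (\<sigma>\<^sup>2 * \<rho>)\<^sup>2"
    proof -
      have "\<sigma>\<^sup>2 * A / K = \<sigma>\<^sup>2 * (\<sigma>\<^sup>2 * \<rho>\<^sup>2)" by (simp only: AK[symmetric] times_divide_eq_right)
      then show ?thesis by algebra
    qed
    then have R: "sqrt (\<sigma>\<^sup>2 * A / K) = \<sigma>\<^sup>2 * \<rho>" using \<rho> by simp
    have \<theta>': "\<theta> = min \<rho> 1" using False by (simp add: \<theta> \<rho>_def)
    have "A / (\<theta> * K) = \<sigma>\<^sup>2 * \<rho>\<^sup>2 / \<theta>"
      using AK by (simp add: mult.commute flip: divide_divide_eq_left)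
    also have "\<dots> \<le> \<sigma>\<^sup>2 * \<rho> + \<sigma>\<^sup>2 * \<rho>\<^sup>2"
      using \<rho> s2 by (auto simp: \<theta>' min_def power2_eq_square)
    finally have "A / (\<theta> * K) \<le> \<sigma>\<^sup>2 * \<rho> + A / K" by (simp add: AK)
    moreover have "\<sigma>\<^sup>2 * \<theta> \<le> \<sigma>\<^sup>2 * \<rho>" using s2 by (simp add: \<theta>')
    ultimately show ?thesis using \<rho> by (simp add: R \<theta>')
  qed
  then show "0 < \<theta>" "\<theta> \<le> 1" "\<sigma>\<^sup>2 * \<theta> \<le> sqrt (\<sigma>\<^sup>2 * A / K)"
    "A / (\<theta> * K) \<le> sqrt (\<sigma>\<^sup>2 * A / K) + A / K" by auto
qed

text \<open>The majorant is taken in the left singular basis of \<open>V\<close> with weights from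
  \<open>(v i)\<^sup>2 + \<epsilon>\<close>. Inserting the directional bounds turns the weighted sum
  back into \<open>T \<epsilon>\<close>, so the expectation is at most
  \<open>\<kappa> * T \<epsilon> powr (2 / b)\<close>, which tends to the claim as
  \<open>\<epsilon>\<close> tends to 0.\<close>

lemma integral_schatten_norm_square_le:
  fixes S :: "'w \<Rightarrow> real ^ 'n ^ 'm" and V :: "real ^ 'k ^ 'm"
  assumes pq: "conjugate_exponents p q" and q2: "q \<le> 2"
    and meas: "S \<in> borel_measurable M"
    and int: "\<And>u. integrable M (\<lambda>\<omega>. (norm (u v* S \<omega>))\<^sup>2)"
    and le: "\<And>u. (\<integral>\<omega>. (norm (u v* S \<omega>))\<^sup>2 \<partial>M) \<le> \<kappa> * (norm (u v* V))\<^sup>2"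
    and \<kappa>: "0 \<le> \<kappa>"
  shows "integrable M (\<lambda>\<omega>. (schatten_norm q (S \<omega>))\<^sup>2)"
    and "(\<integral>\<omega>. (schatten_norm q (S \<omega>))\<^sup>2 \<partial>M) \<le> \<kappa> * (schatten_norm q V)\<^sup>2"
proof -
  obtain b where b: "q = ereal b" "1 \<le> b"
    using pq by (auto simp: conjugate_exponents_def one_ereal_def)
  have b2: "0 < b" "b \<le> 2" using b q2 by auto
  obtain u v where V: "singular_basis V u v" by (rule singular_basis_exists)
  have u: "orthonormal_family u" and v0: "\<And>i. 0 \<le> v i"
    and gV: "\<And>i. (norm (u i v* V))\<^sup>2 = (v i)\<^sup>2"
    using V by (auto simp: singular_basis_def power2_norm_eq_inner)
  have [measurable]: "schatten_norm q \<in> borel_measurable (borel :: (real ^ 'n ^ 'm) measure)"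
    by (rule borel_measurable_continuous_onI[OF continuous_on_schatten_norm[OF pq]])
  note [measurable] = meas
  define T where "T \<epsilon> = (\<Sum>i\<in>UNIV. ((v i)\<^sup>2 + \<epsilon>) powr (b / 2))" for \<epsilon>
  define Q where "Q \<epsilon> \<omega> = T \<epsilon> powr (2 / b - 1) *
    (\<Sum>i\<in>UNIV. ((v i)\<^sup>2 + \<epsilon>) powr (b / 2 - 1) * (norm (u i v* S \<omega>))\<^sup>2)" for \<epsilon> \<omega>
  have major: "(schatten_norm q (S \<omega>))\<^sup>2 \<le> Q \<epsilon> \<omega>" if "0 < \<epsilon>" for \<epsilon> \<omega>
    unfolding Q_def T_def b using that b2
    by (intro schatten_norm_quadratic_majorant[OF u]) (auto intro: add_nonneg_pos)
  have Qint: "integrable M (Q \<epsilon>)" for \<epsilon>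
    unfolding Q_def by (intro integrable_mult_right Bochner_Integration.integrable_sum int)
  \<comment> \<open>Every positive \<open>\<epsilon>\<close> gives an integrable majorant; 1 is an
    arbitrary choice.\<close>
  show SI: "integrable M (\<lambda>\<omega>. (schatten_norm q (S \<omega>))\<^sup>2)"
    by (rule Bochner_Integration.integrable_bound[OF Qint[of 1]])
      (use major[of 1] in \<open>auto intro!: AE_I2 order_trans[OF _ abs_ge_self]\<close>)
  have bound: "(\<integral>\<omega>. (schatten_norm q (S \<omega>))\<^sup>2 \<partial>M) \<le> \<kappa> * T \<epsilon> powr (2 / b)" if \<epsilon>: "0 < \<epsilon>" for \<epsilon>
  proof -
    have "(\<integral>\<omega>. (schatten_norm q (S \<omega>))\<^sup>2 \<partial>M) \<le> (\<integral>\<omega>. Q \<epsilon> \<omega> \<partial>M)"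
      by (intro integral_mono SI Qint major \<epsilon>)
    also have "\<dots> = T \<epsilon> powr (2 / b - 1) *
        (\<Sum>i\<in>UNIV. ((v i)\<^sup>2 + \<epsilon>) powr (b / 2 - 1) * (\<integral>\<omega>. (norm (u i v* S \<omega>))\<^sup>2 \<partial>M))"
      unfolding Q_def by (simp add: Bochner_Integration.integral_sum int)
    also have "\<dots> \<le> T \<epsilon> powr (2 / b - 1) * (\<Sum>i\<in>UNIV. \<kappa> * ((v i)\<^sup>2 + \<epsilon>) powr (b / 2))"
    proof (intro mult_left_mono sum_mono)
      fix i
      have "(\<integral>\<omega>. (norm (u i v* S \<omega>))\<^sup>2 \<partial>M) \<le> \<kappa> * ((v i)\<^sup>2 + \<epsilon>)"
      proof -
        have "\<kappa> * (v i)\<^sup>2 \<le> \<kappa> * ((v i)\<^sup>2 + \<epsilon>)" using \<kappa> \<epsilon> by (intro mult_left_mono) auto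
        then show ?thesis using le[of "u i"] unfolding gV by linarith
      qed
      then have "((v i)\<^sup>2 + \<epsilon>) powr (b / 2 - 1) * (\<integral>\<omega>. (norm (u i v* S \<omega>))\<^sup>2 \<partial>M)
          \<le> ((v i)\<^sup>2 + \<epsilon>) powr (b / 2 - 1) * (\<kappa> * ((v i)\<^sup>2 + \<epsilon>))"
        by (intro mult_left_mono) auto
      also have "\<dots> = \<kappa> * ((v i)\<^sup>2 + \<epsilon>) powr (b / 2)"
        using \<epsilon> powr_mult_base[of "(v i)\<^sup>2 + \<epsilon>" "b / 2 - 1"] by (simp add: mult_ac)
      finally show "((v i)\<^sup>2 + \<epsilon>) powr (b / 2 - 1) * (\<integral>\<omega>. (norm (u i v* S \<omega>))\<^sup>2 \<partial>M)
          \<le> \<kappa> * ((v i)\<^sup>2 + \<epsilon>) powr (b / 2)" .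
    qed simp
    also have "\<dots> = \<kappa> * (T \<epsilon> powr (2 / b - 1) * T \<epsilon>)"
      by (simp add: T_def sum_distrib_left mult_ac)
    also have "\<dots> = \<kappa> * T \<epsilon> powr (2 / b)"
    proof -
      have "0 \<le> T \<epsilon>" unfolding T_def by (intro sum_nonneg) auto
      then show ?thesis using powr_mult_base[of "T \<epsilon>" "2 / b - 1"] by (simp add: mult.commute)
    qed
    finally show ?thesis .
  qed
  \<comment> \<open>The bases may tend to 0; continuity there rests on the positive exponents
    \<open>b / 2\<close> and \<open>2 / b\<close>.\<close>
  have "((\<lambda>\<epsilon>. \<kappa> * T \<epsilon> powr (2 / b)) \<longlongrightarrow> \<kappa> * T 0 powr (2 / b)) (at_right 0)"
  proof -
    have "((\<lambda>\<epsilon>. T \<epsilon>) \<longlongrightarrow> T 0) (at_right 0)"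
      unfolding T_def
    proof (intro tendsto_sum tendsto_powr')
      fix i
      show "((\<lambda>\<epsilon>. (v i)\<^sup>2 + \<epsilon>) \<longlongrightarrow> (v i)\<^sup>2 + 0) (at_right 0)"
        by (intro tendsto_intros)
      show "(v i)\<^sup>2 + 0 \<noteq> 0 \<or> 0 < b / 2 \<and> (\<forall>\<^sub>F \<epsilon> in at_right 0. 0 \<le> (v i)\<^sup>2 + \<epsilon>)"
        using b2 by (auto simp: eventually_at_right_less intro!: eventually_at_rightI[of 0 1])
    qed (use b2 in auto)
    moreover have "0 \<le> T \<epsilon>" for \<epsilon> unfolding T_def by (intro sum_nonneg) auto
    ultimately show ?thesis using b2 by (intro tendsto_mult tendsto_const tendsto_powr') auto
  qed
  moreover have "\<forall>\<^sub>F \<epsilon> in at_right (0::real). (\<integral>\<omega>. (schatten_norm q (S \<omega>))\<^sup>2 \<partial>M) \<le> \<kappa> * T \<epsilon> powr (2 / b)"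
    using bound by (auto intro!: eventually_at_rightI[of 0 1])
  ultimately have "(\<integral>\<omega>. (schatten_norm q (S \<omega>))\<^sup>2 \<partial>M) \<le> \<kappa> * T 0 powr (2 / b)"
    by (intro tendsto_lowerbound) auto
  also have "T 0 powr (2 / b) = (schatten_norm q V)\<^sup>2"
  proof -
    have "((v i)\<^sup>2) powr (b / 2) = v i powr b" for i
      using v0[of i] b2 powr_powr[of "v i" 2 "b / 2"] by (cases "v i = 0") auto
    then have "T 0 = (\<Sum>i\<in>UNIV. v i powr b)" by (simp add: T_def)
    then show ?thesis
      using powr_powr[of "\<Sum>i\<in>UNIV. v i powr b" "1 / b" 2]
      by (simp add: b schatten_norm_finite[OF V] powr_realpow' sum_nonneg)
  qed
  finally show "(\<integral>\<omega>. (schatten_norm q (S \<omega>))\<^sup>2 \<partial>M) \<le> \<kappa> * (schatten_norm q V)\<^sup>2" .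
qed

subsection \<open>Accumulated noise\<close>

text \<open>Arbitrary index sets are needed because samples inside a batch are revealed one at a
  time, whereas \<open>sample_algebra\<close> sees only whole batches.\<close>

definition history_algebra ::
  "'w measure \<Rightarrow> 'x measure \<Rightarrow> (nat \<Rightarrow> nat \<Rightarrow> 'w \<Rightarrow> 'x) \<Rightarrow> (nat \<times> nat) set \<Rightarrow> 'w measure" where
  "history_algebra M \<Xi> \<xi>s J =
     sigma (space M) {\<xi>s s i -` A \<inter> space M | s i A. (s, i) \<in> J \<and> A \<in> sets \<Xi>}"

lemma sample_algebra_eq_history:
  "sample_algebra M \<Xi> B \<xi>s k = history_algebra M \<Xi> \<xi>s ({..k} \<times> {1..B})"
  unfolding sample_algebra_def history_algebra_def by (rule arg_cong[of _ _ "sigma (space M)"]) auto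

lemma space_history_algebra [simp]: "space (history_algebra M \<Xi> \<xi>s J) = space M"
  by (simp add: history_algebra_def space_measure_of_conv)

lemma sets_history_algebra:
  "sets (history_algebra M \<Xi> \<xi>s J) =
     sigma_sets (space M) {\<xi>s s i -` A \<inter> space M | s i A. (s, i) \<in> J \<and> A \<in> sets \<Xi>}"
  unfolding history_algebra_def by (rule sets_measure_of) auto

lemma measurable_history_mono:
  assumes "f \<in> measurable (history_algebra M \<Xi> \<xi>s J) N" and "J \<subseteq> J'"
  shows "f \<in> measurable (history_algebra M \<Xi> \<xi>s J') N"
proof -
  have "sets (history_algebra M \<Xi> \<xi>s J) \<subseteq> sets (history_algebra M \<Xi> \<xi>s J')"
    unfolding sets_history_algebra using assms(2) by (intro sigma_sets_mono') auto
  then show ?thesis using assms(1) measurable_mono[of N N "history_algebra M \<Xi> \<xi>s J" "history_algebra M \<Xi> \<xi>s J'"]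
    by auto
qed

lemma measurable_history_sample:
  assumes "\<xi>s k i \<in> measurable M \<Xi>" and "(k, i) \<in> J"
  shows "\<xi>s k i \<in> measurable (history_algebra M \<Xi> \<xi>s J) \<Xi>"
proof (rule measurableI)
  show "\<xi>s k i x \<in> space \<Xi>" if "x \<in> space (history_algebra M \<Xi> \<xi>s J)" for x
    using that assms(1) by (auto dest: measurable_space)
  show "\<xi>s k i -` A \<inter> space (history_algebra M \<Xi> \<xi>s J) \<in> sets (history_algebra M \<Xi> \<xi>s J)"
    if "A \<in> sets \<Xi>" for A
    unfolding sets_history_algebra space_history_algebra
    using that assms(2) by (intro sigma_sets.Basic) auto
qed

lemma history_algebra_subalgebra:
  assumes "\<And>s i. (s, i) \<in> J \<Longrightarrow> \<xi>s s i \<in> measurable M \<Xi>"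
  shows "sets (history_algebra M \<Xi> \<xi>s J) \<subseteq> sets M"
  unfolding sets_history_algebra
  by (rule sets.sigma_sets_subset) (auto intro!: measurable_sets[OF assms])

text \<open>Independence is put as a product law so that Fubini can replace conditional expectation.
  It follows by grouping the independent samples into two disjoint blocks and comparing the measures
  on rectangles.\<close>

lemma (in prob_space) distr_history_sample:
  assumes indep: "indep_vars (\<lambda>_. \<Xi>) (\<lambda>(k, i). \<xi>s k i) I"
    and J: "J \<subseteq> I" and ki: "(k, i) \<in> I" "(k, i) \<notin> J"
    and P: "P \<in> measurable (history_algebra M \<Xi> \<xi>s J) N"
  shows "P \<in> measurable M N"
    and "distr M N P \<Otimes>\<^sub>M distr M \<Xi> (\<xi>s k i) = distr M (N \<Otimes>\<^sub>M \<Xi>) (\<lambda>\<omega>. (P \<omega>, \<xi>s k i \<omega>))"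
proof -
  have rv: "random_variable \<Xi> (\<xi>s s j)" if "(s, j) \<in> I" for s j
    using indep that by (auto simp: indep_vars_def2)
  define E where "E = (\<lambda>(s, j). {\<xi>s s j -` A \<inter> space M |A. A \<in> sets \<Xi>})"
  have E: "E = (\<lambda>x. {(case x of (s, j) \<Rightarrow> \<xi>s s j) -` A \<inter> space M |A. A \<in> sets \<Xi>})"
    by (auto simp: E_def fun_eq_iff)
  \<comment> \<open>Two blocks: the past at \<open>True\<close>, the fresh sample at
    \<open>False\<close>.\<close>
  define K where "K = case_bool J {(k, i)}"
  have ind: "indep_sets (\<lambda>b. sigma_sets (space M) (\<Union>x\<in>K b. E x)) UNIV"
  proof (rule indep_sets_collect_sigma)
    show "indep_sets E (\<Union>b\<in>UNIV. K b)"
    proof (rule indep_sets_mono_index)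
      show "indep_sets E I" using indep unfolding indep_vars_def2 E by auto
      show "(\<Union>b\<in>UNIV. K b) \<subseteq> I" using J ki by (auto simp: K_def split: bool.splits)
    qed
    show "Int_stable (E x)" for x
      unfolding E Int_stable_def
    proof safe
      fix A B assume "A \<in> sets \<Xi>" "B \<in> sets \<Xi>"
      then show "\<exists>C. (case x of (s, j) \<Rightarrow> \<xi>s s j) -` A \<inter> space M \<inter> ((case x of (s, j) \<Rightarrow> \<xi>s s j) -` B \<inter> space M)
          = (case x of (s, j) \<Rightarrow> \<xi>s s j) -` C \<inter> space M \<and> C \<in> sets \<Xi>"
        by (intro exI[of _ "A \<inter> B"]) auto
    qed
    show "disjoint_family_on K UNIV"
      using ki by (auto simp: disjoint_family_on_def K_def split: bool.splits)
  qed
  have KJ: "(\<Union>x\<in>J. E x) = {\<xi>s s i -` A \<inter> space M | s i A. (s, i) \<in> J \<and> A \<in> sets \<Xi>}"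
    by (auto simp: E_def)
  have "indep_set (sets (history_algebra M \<Xi> \<xi>s J)) (E (k, i))"
    unfolding indep_set_def
  proof (rule indep_sets_mono_sets[OF ind])
    fix b :: bool
    show "case_bool (sets (history_algebra M \<Xi> \<xi>s J)) (E (k, i)) b
        \<subseteq> sigma_sets (space M) (\<Union> (E ` K b))"
      by (cases b) (auto simp: K_def sets_history_algebra KJ)
  qed
  then have indep_prob: "prob (U \<inter> W) = prob U * prob W"
    if "U \<in> sets (history_algebra M \<Xi> \<xi>s J)" "W \<in> E (k, i)" for U W
    using that by (simp add: indep_sets2_eq)
  have x: "\<xi>s k i \<in> measurable M \<Xi>" using rv[OF ki(1)] .
  show PM: "P \<in> measurable M N"
  proof -
    have "sets (history_algebra M \<Xi> \<xi>s J) \<subseteq> sets M"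
      using rv J by (intro history_algebra_subalgebra) auto
    then show ?thesis using P measurable_mono[of N N "history_algebra M \<Xi> \<xi>s J" M] by auto
  qed
  interpret P: prob_space "distr M N P" by (rule prob_space_distr[OF PM])
  interpret D: prob_space "distr M \<Xi> (\<xi>s k i)" by (rule prob_space_distr[OF x])
  show "distr M N P \<Otimes>\<^sub>M distr M \<Xi> (\<xi>s k i) = distr M (N \<Otimes>\<^sub>M \<Xi>) (\<lambda>\<omega>. (P \<omega>, \<xi>s k i \<omega>))"
  proof (rule pair_measure_eqI)
    show "sigma_finite_measure (distr M N P)" "sigma_finite_measure (distr M \<Xi> (\<xi>s k i))" ..
    show "sets (distr M N P \<Otimes>\<^sub>M distr M \<Xi> (\<xi>s k i))
        = sets (distr M (N \<Otimes>\<^sub>M \<Xi>) (\<lambda>\<omega>. (P \<omega>, \<xi>s k i \<omega>)))"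
      by (simp cong: sets_pair_measure_cong)
    fix U W assume "U \<in> sets (distr M N P)" "W \<in> sets (distr M \<Xi> (\<xi>s k i))"
    then have U: "U \<in> sets N" and W: "W \<in> sets \<Xi>" by auto
    have "P -` U \<inter> space M \<in> sets (history_algebra M \<Xi> \<xi>s J)"
      using measurable_sets[OF P U] by simp
    moreover have "\<xi>s k i -` W \<inter> space M \<in> E (k, i)" using W by (auto simp: E_def)
    ultimately have eq: "prob ((P -` U \<inter> space M) \<inter> (\<xi>s k i -` W \<inter> space M))
        = prob (P -` U \<inter> space M) * prob (\<xi>s k i -` W \<inter> space M)"
      by (rule indep_prob)
    have "(\<lambda>\<omega>. (P \<omega>, \<xi>s k i \<omega>)) -` (U \<times> W) \<inter> space M
        = (P -` U \<inter> space M) \<inter> (\<xi>s k i -` W \<inter> space M)" by auto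
    then show "emeasure (distr M N P) U * emeasure (distr M \<Xi> (\<xi>s k i)) W
        = emeasure (distr M (N \<Otimes>\<^sub>M \<Xi>) (\<lambda>\<omega>. (P \<omega>, \<xi>s k i \<omega>))) (U \<times> W)"
      using U W PM x by (simp add: emeasure_distr measurable_Pair emeasure_eq_measure eq ennreal_mult'')
  qed
qed

text \<open>Orthogonality of a martingale increment: \<open>A\<close> and \<open>Y\<close> carry the
  past, \<open>x\<close> is fresh, and averaging over \<open>x\<close> first kills the cross term.
  The bound \<open>c\<close> is uniform in the state, so the increment is square integrable without
  any moment of \<open>Y\<close>.\<close>

lemma (in prob_space) indep_increment_second_moment:
  fixes A :: "'a \<Rightarrow> 'v::euclidean_space" and Y :: "'a \<Rightarrow> 'y::second_countable_topology"
    and h :: "'y \<times> 'x \<Rightarrow> 'v"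
  assumes AY: "(\<lambda>\<omega>. (A \<omega>, Y \<omega>)) \<in> measurable M (borel \<Otimes>\<^sub>M borel)" and x [measurable]: "x \<in> measurable M \<Xi>"
    and indep: "distr M (borel \<Otimes>\<^sub>M borel) (\<lambda>\<omega>. (A \<omega>, Y \<omega>)) \<Otimes>\<^sub>M distr M \<Xi> x
      = distr M ((borel \<Otimes>\<^sub>M borel) \<Otimes>\<^sub>M \<Xi>) (\<lambda>\<omega>. ((A \<omega>, Y \<omega>), x \<omega>))"
    and h [measurable]: "h \<in> borel_measurable (borel \<Otimes>\<^sub>M \<Xi>)"
    and h_int: "\<And>y. integrable (distr M \<Xi> x) (\<lambda>z. h (y, z))"
    and h_mean: "\<And>y. (\<integral>z. h (y, z) \<partial>distr M \<Xi> x) = 0"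
    and h2_int: "\<And>y. integrable (distr M \<Xi> x) (\<lambda>z. (norm (h (y, z)))\<^sup>2)"
    and h2: "\<And>y. (\<integral>z. (norm (h (y, z)))\<^sup>2 \<partial>distr M \<Xi> x) \<le> c"
    and A2: "integrable M (\<lambda>\<omega>. (norm (A \<omega>))\<^sup>2)"
  shows "integrable M (\<lambda>\<omega>. (norm (A \<omega> + a *\<^sub>R h (Y \<omega>, x \<omega>)))\<^sup>2)" (is ?int)
    and "(\<integral>\<omega>. (norm (A \<omega> + a *\<^sub>R h (Y \<omega>, x \<omega>)))\<^sup>2 \<partial>M) \<le> (\<integral>\<omega>. (norm (A \<omega>))\<^sup>2 \<partial>M) + a\<^sup>2 * c" (is ?le)
proof -
  let ?N = "borel \<Otimes>\<^sub>M borel :: ('v \<times> 'y) measure"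
  define P where "P = distr M ?N (\<lambda>\<omega>. (A \<omega>, Y \<omega>))"
  define D where "D = distr M \<Xi> x"
  have prod: "P \<Otimes>\<^sub>M D = distr M (?N \<Otimes>\<^sub>M \<Xi>) (\<lambda>\<omega>. ((A \<omega>, Y \<omega>), x \<omega>))"
    using indep by (simp add: P_def D_def)
  have [measurable]: "A \<in> borel_measurable M" "Y \<in> borel_measurable M"
    using measurable_compose[OF AY measurable_fst] measurable_compose[OF AY measurable_snd] by auto
  interpret P: prob_space P unfolding P_def by (rule prob_space_distr[OF AY])
  interpret D: prob_space D unfolding D_def by (rule prob_space_distr[OF x])
  interpret PD: pair_prob_space P D ..
  have sets_PD [measurable_cong]: "sets P = sets ?N" "sets D = sets \<Xi>" by (auto simp: P_def D_def)
  have prod_meas: "(\<lambda>\<omega>. ((A \<omega>, Y \<omega>), x \<omega>)) \<in> measurable M (?N \<Otimes>\<^sub>M \<Xi>)" by measurable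
  have int_iff: "integrable (P \<Otimes>\<^sub>M D) F \<longleftrightarrow> integrable M (\<lambda>\<omega>. F ((A \<omega>, Y \<omega>), x \<omega>))"
    if "F \<in> borel_measurable (?N \<Otimes>\<^sub>M \<Xi>)" for F :: "('v \<times> 'y) \<times> 'x \<Rightarrow> real"
    unfolding prod by (rule integrable_distr_eq[OF prod_meas that])
  have int_eq: "integral\<^sup>L (P \<Otimes>\<^sub>M D) F = (\<integral>\<omega>. F ((A \<omega>, Y \<omega>), x \<omega>) \<partial>M)"
    if "F \<in> borel_measurable (?N \<Otimes>\<^sub>M \<Xi>)" for F :: "('v \<times> 'y) \<times> 'x \<Rightarrow> real"
    unfolding prod by (rule integral_distr[OF prod_meas that])
  define H2 where "H2 = (\<lambda>w :: ('v \<times> 'y) \<times> 'x. (norm (h (snd (fst w), snd w)))\<^sup>2)"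
  define H1 where "H1 = (\<lambda>w :: ('v \<times> 'y) \<times> 'x. inner (fst (fst w)) (h (snd (fst w), snd w)))"
  have H2m [measurable]: "H2 \<in> borel_measurable (?N \<Otimes>\<^sub>M \<Xi>)" unfolding H2_def by measurable
  have H1m [measurable]: "H1 \<in> borel_measurable (?N \<Otimes>\<^sub>M \<Xi>)" unfolding H1_def by measurable
  have inner_int: "integrable P (\<lambda>w. \<integral>z. H2 (w, z) \<partial>D)"
  proof (rule P.integrable_const_bound[where B = c])
    show "(\<lambda>w. \<integral>z. H2 (w, z) \<partial>D) \<in> borel_measurable P" by measurable
    show "AE w in P. norm (\<integral>z. H2 (w, z) \<partial>D) \<le> c"
      using h2 by (auto simp: H2_def D_def)
  qed
  have H2i: "integrable (P \<Otimes>\<^sub>M D) H2"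
  proof (rule PD.Fubini_integrable)
    show "H2 \<in> borel_measurable (P \<Otimes>\<^sub>M D)" by measurable
    show "integrable P (\<lambda>w. \<integral>z. norm (H2 (w, z)) \<partial>D)"
      using inner_int by (simp add: H2_def)
    show "AE w in P. integrable D (\<lambda>z. H2 (w, z))"
      using h2_int by (auto simp: H2_def D_def)
  qed
  define Z where "Z \<omega> = h (Y \<omega>, x \<omega>)" for \<omega>
  have [measurable]: "Z \<in> borel_measurable M" unfolding Z_def by measurable
  have Z2: "integrable M (\<lambda>\<omega>. (norm (Z \<omega>))\<^sup>2)"
    using H2i int_iff[OF H2m] by (simp add: H2_def Z_def)
  have "(\<integral>\<omega>. (norm (Z \<omega>))\<^sup>2 \<partial>M) = (\<integral>w. \<integral>z. H2 (w, z) \<partial>D \<partial>P)"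
    using int_eq[OF H2m] PD.integral_fst'[OF H2i] by (simp add: H2_def Z_def)
  also have "\<dots> \<le> (\<integral>w. c \<partial>P)"
    using h2 by (intro integral_mono inner_int) (auto simp: H2_def D_def)
  finally have EZ2: "(\<integral>\<omega>. (norm (Z \<omega>))\<^sup>2 \<partial>M) \<le> c" by (simp add: P.prob_space)
  \<comment> \<open>Iterated integration of the cross term is legitimate only once its integrability
    is known; this is where \<open>A2\<close> enters.\<close>
  have AZ: "integrable M (\<lambda>\<omega>. inner (A \<omega>) (Z \<omega>))"
  proof (rule Bochner_Integration.integrable_bound)
    show "integrable M (\<lambda>\<omega>. (norm (A \<omega>))\<^sup>2 + (norm (Z \<omega>))\<^sup>2)" by (intro Bochner_Integration.integrable_add A2 Z2)
    have "\<bar>inner (A \<omega>) (Z \<omega>)\<bar> \<le> (norm (A \<omega>))\<^sup>2 + (norm (Z \<omega>))\<^sup>2" for \<omega>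
      using Cauchy_Schwarz_ineq2[of "A \<omega>" "Z \<omega>"] sum_squares_bound[of "norm (A \<omega>)" "norm (Z \<omega>)"]
        mult_nonneg_nonneg[OF norm_ge_zero[of "A \<omega>"] norm_ge_zero[of "Z \<omega>"]] by linarith
    then show "AE \<omega> in M. norm (inner (A \<omega>) (Z \<omega>)) \<le> norm ((norm (A \<omega>))\<^sup>2 + (norm (Z \<omega>))\<^sup>2)" by simp
  qed measurable
  then have H1i: "integrable (P \<Otimes>\<^sub>M D) H1"
    using int_iff[OF H1m] by (simp add: H1_def Z_def)
  have EAZ: "(\<integral>\<omega>. inner (A \<omega>) (Z \<omega>) \<partial>M) = 0"
  proof -
    have "(\<integral>\<omega>. inner (A \<omega>) (Z \<omega>) \<partial>M) = (\<integral>w. \<integral>z. H1 (w, z) \<partial>D \<partial>P)"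
      using int_eq[OF H1m] PD.integral_fst'[OF H1i] by (simp add: H1_def Z_def)
    also have "\<dots> = 0"
      using h_int h_mean by (simp add: H1_def D_def)
    finally show ?thesis .
  qed
  have expand: "(norm (A \<omega> + a *\<^sub>R Z \<omega>))\<^sup>2 = (norm (A \<omega>))\<^sup>2 + 2 * a * inner (A \<omega>) (Z \<omega>) + a\<^sup>2 * (norm (Z \<omega>))\<^sup>2" for \<omega>
    unfolding power2_norm_eq_inner
    by (simp add: inner_add_left inner_add_right inner_commute power2_eq_square)
  show ?int
    unfolding Z_def[symmetric] expand using A2 AZ Z2 by simp
  have "(\<integral>\<omega>. (norm (A \<omega> + a *\<^sub>R Z \<omega>))\<^sup>2 \<partial>M) = (\<integral>\<omega>. (norm (A \<omega>))\<^sup>2 \<partial>M) + a\<^sup>2 * (\<integral>\<omega>. (norm (Z \<omega>))\<^sup>2 \<partial>M)"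
    unfolding expand using A2 AZ Z2 by (simp add: EAZ)
  also have "\<dots> \<le> (\<integral>\<omega>. (norm (A \<omega>))\<^sup>2 \<partial>M) + a\<^sup>2 * c"
    using EZ2 by (intro add_left_mono mult_left_mono) auto
  finally show ?le by (simp add: Z_def)
qed

section \<open>One-sided products and the noise along a run\<close>

lemma bounded_linear_left_mult: "bounded_linear (\<lambda>A :: real ^ 'n ^ 'm. u v* A)"
  unfolding linear_conv_bounded_linear[symmetric]
  by (rule linearI) (simp_all add: vec_eq_iff vector_matrix_mult_def sum_distrib_left sum.distrib algebra_simps)

lemma left_mult_add: "u v* (A + B) = u v* A + u v* (B :: real ^ 'n ^ 'm)"
  using bounded_linear.linear[OF bounded_linear_left_mult] by (rule linear_add)

lemma left_mult_scaleR: "u v* (c *\<^sub>R A) = c *\<^sub>R (u v* (A :: real ^ 'n ^ 'm))"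
  using bounded_linear.linear[OF bounded_linear_left_mult] by (rule linear_scale)

lemma bounded_linear_quadratic_form: "bounded_linear (\<lambda>W :: real ^ 'm ^ 'm. inner u (W *v u))"
  unfolding linear_conv_bounded_linear[symmetric]
  by (rule linearI) (simp_all add: matrix_vector_mult_add_rdistrib inner_add_right scaleR_matrix_vector_assoc[symmetric])

text \<open>The stochastic side of the method: an adapted sequence of states and unbiased samples
  with bounded covariance. The rule that produces the states enters only in the final
  theorem.\<close>

locale stochastic_gradient_run = prob_space M
  for M :: "'w measure" +
  fixes gradf :: "real ^ 'n ^ 'm \<Rightarrow> real ^ 'n ^ 'm" and V :: "real ^ 'm ^ 'm"
    and \<Xi> :: "'x measure" and \<xi> :: "'w \<Rightarrow> 'x" and \<xi>s :: "nat \<Rightarrow> nat \<Rightarrow> 'w \<Rightarrow> 'x"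
    and G :: "real ^ 'n ^ 'm \<Rightarrow> 'x \<Rightarrow> real ^ 'n ^ 'm"
    and X\<^sub>0 :: "real ^ 'n ^ 'm" and X :: "nat \<Rightarrow> 'w \<Rightarrow> real ^ 'n ^ 'm" and B :: nat
  assumes gradf_measurable [measurable]: "gradf \<in> borel_measurable borel"
    and xi_random [measurable]: "\<xi> \<in> measurable M \<Xi>"
    and G_measurable [measurable]: "(\<lambda>(Y, x). G Y x) \<in> borel_measurable (borel \<Otimes>\<^sub>M \<Xi>)"
    and G_integrable: "\<And>Y. integrable M (\<lambda>\<omega>. G Y (\<xi> \<omega>))"
    and G_unbiased: "\<And>Y. (\<integral>\<omega>. G Y (\<xi> \<omega>) \<partial>M) = gradf Y"
    and noise_integrable:
      "\<And>Y. integrable M (\<lambda>\<omega>. (G Y (\<xi> \<omega>) - gradf Y) ** transpose (G Y (\<xi> \<omega>) - gradf Y))"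
    and noise_bound:
      "\<And>Y. loewner_le
         (\<integral>\<omega>. (G Y (\<xi> \<omega>) - gradf Y) ** transpose (G Y (\<xi> \<omega>) - gradf Y) \<partial>M) (V ** transpose V)"
    and B_pos: "1 \<le> B"
    and samples: "iid_copies M \<Xi> \<xi> B \<xi>s"
    and start: "\<And>\<omega>. \<omega> \<in> space M \<Longrightarrow> X 0 \<omega> = X\<^sub>0"
    and adapted: "\<And>k. X (Suc k) \<in> borel_measurable (sample_algebra M \<Xi> B \<xi>s k)"
begin

definition noise :: "real ^ 'n ^ 'm \<Rightarrow> 'x \<Rightarrow> real ^ 'n ^ 'm" where
  "noise Y z = G Y z - gradf Y"

abbreviation history :: "(nat \<times> nat) set \<Rightarrow> 'w measure" where
  "history \<equiv> history_algebra M \<Xi> \<xi>s"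

lemma indep_samples: "indep_vars (\<lambda>_. \<Xi>) (\<lambda>(k, i). \<xi>s k i) (UNIV \<times> {1..B})"
  using samples by (simp add: iid_copies_def)

lemma sample_measurable: "i \<in> {1..B} \<Longrightarrow> \<xi>s k i \<in> measurable M \<Xi>"
  using indep_samples by (auto simp: indep_vars_def2)

lemma noise_measurable [measurable]: "(\<lambda>(Y, z). noise Y z) \<in> borel_measurable (borel \<Otimes>\<^sub>M \<Xi>)"
proof -
  have "(\<lambda>x. gradf (fst x)) \<in> borel_measurable (borel \<Otimes>\<^sub>M \<Xi>)" by measurable
  then show ?thesis
    using borel_measurable_diff[OF G_measurable, of "\<lambda>x. gradf (fst x)"]
    by (simp add: noise_def case_prod_unfold)
qed

lemma noise_section_measurable [measurable]: "noise Y \<in> borel_measurable \<Xi>"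
  using measurable_compose[OF measurable_Pair1' noise_measurable, of Y] by simp

lemma left_mult_measurable [measurable]:
  "(\<lambda>A :: real ^ 'n ^ 'm. u v* A) \<in> borel_measurable borel"
  using linear_continuous_on[OF bounded_linear_left_mult] by (rule borel_measurable_continuous_onI)

lemma left_noise_integrable: "integrable (distr M \<Xi> \<xi>) (\<lambda>z. u v* noise Y z)"
  and left_noise_mean: "(\<integral>z. u v* noise Y z \<partial>distr M \<Xi> \<xi>) = 0"
proof -
  have int: "integrable M (\<lambda>\<omega>. noise Y (\<xi> \<omega>))"
    unfolding noise_def by (intro Bochner_Integration.integrable_diff G_integrable) simp
  have "(\<integral>\<omega>. noise Y (\<xi> \<omega>) \<partial>M) = 0"
    unfolding noise_def by (simp add: G_integrable G_unbiased prob_space)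
  then have "(\<integral>\<omega>. u v* noise Y (\<xi> \<omega>) \<partial>M) = 0"
    using integral_bounded_linear[OF bounded_linear_left_mult int, of u] by simp
  moreover have "integrable M (\<lambda>\<omega>. u v* noise Y (\<xi> \<omega>))"
    by (rule integrable_bounded_linear[OF bounded_linear_left_mult int])
  ultimately show "integrable (distr M \<Xi> \<xi>) (\<lambda>z. u v* noise Y z)"
    "(\<integral>z. u v* noise Y z \<partial>distr M \<Xi> \<xi>) = 0"
    by (simp_all add: integrable_distr_eq integral_distr)
qed

text \<open>The squared length of \<open>u v* A\<close> is the quadratic form of
  \<open>A ** transpose A\<close> at \<open>u\<close>. It is linear in that matrix, so it commutes
  with the integral, and the Loewner bound is tested at \<open>u\<close>.\<close>

lemma left_noise_square_integrable: "integrable (distr M \<Xi> \<xi>) (\<lambda>z. (norm (u v* noise Y z))\<^sup>2)"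
  and left_noise_square_le: "(\<integral>z. (norm (u v* noise Y z))\<^sup>2 \<partial>distr M \<Xi> \<xi>) \<le> (norm (u v* V))\<^sup>2"
proof -
  let ?W = "\<lambda>\<omega>. noise Y (\<xi> \<omega>) ** transpose (noise Y (\<xi> \<omega>))"
  have W: "integrable M ?W" using noise_integrable[of Y] by (simp add: noise_def)
  \<comment> \<open>The column type is left free because the identity serves both the noise and the
    square matrix \<open>V\<close>.\<close>
  have sq: "(norm (u v* A))\<^sup>2 = inner u ((A ** transpose A) *v u)" for A :: "real ^ 'k ^ 'm"
    by (simp add: power2_norm_eq_inner inner_left_mult)
  have "integrable M (\<lambda>\<omega>. (norm (u v* noise Y (\<xi> \<omega>)))\<^sup>2)"
    unfolding sq by (rule integrable_bounded_linear[OF bounded_linear_quadratic_form W])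
  moreover have "(\<integral>\<omega>. (norm (u v* noise Y (\<xi> \<omega>)))\<^sup>2 \<partial>M) = inner u ((\<integral>\<omega>. ?W \<omega> \<partial>M) *v u)"
    unfolding sq by (rule integral_bounded_linear[OF bounded_linear_quadratic_form W])
  moreover have "\<dots> \<le> (norm (u v* V))\<^sup>2"
    unfolding sq using noise_bound[of Y]
    by (simp add: noise_def loewner_le_def positive_semidefinite_def matrix_vector_mult_diff_rdistrib inner_diff_right)
  ultimately show "integrable (distr M \<Xi> \<xi>) (\<lambda>z. (norm (u v* noise Y z))\<^sup>2)"
    "(\<integral>z. (norm (u v* noise Y z))\<^sup>2 \<partial>distr M \<Xi> \<xi>) \<le> (norm (u v* V))\<^sup>2"
    by (simp_all add: integrable_distr_eq integral_distr)
qed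

text \<open>\<open>X k\<close> is determined by the batches strictly before \<open>k\<close>, which
  is what makes batch \<open>k\<close> fresh for it. \<open>X 0\<close> is constant on the space and
  needs no sample.\<close>

lemma state_history_measurable:
  assumes "{..<k} \<times> {1..B} \<subseteq> J"
  shows "X k \<in> borel_measurable (history J)"
proof (cases k)
  case 0
  then show ?thesis by (subst measurable_cong[of _ _ "\<lambda>_. X\<^sub>0"]) (auto simp: start)
next
  case (Suc j)
  have "X k \<in> borel_measurable (history ({..j} \<times> {1..B}))"
    using adapted[of j] by (simp add: Suc sample_algebra_eq_history)
  then show ?thesis by (rule measurable_history_mono) (use assms in \<open>auto simp: Suc\<close>)
qed

lemma noise_history_measurable:
  assumes "{..<k} \<times> {1..B} \<subseteq> J" "(k, i) \<in> J" "i \<in> {1..B}"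
  shows "(\<lambda>\<omega>. noise (X k \<omega>) (\<xi>s k i \<omega>)) \<in> borel_measurable (history J)"
  using measurable_compose[OF measurable_Pair[OF state_history_measurable[OF assms(1)]
      measurable_history_sample[of \<xi>s k i, OF sample_measurable[OF assms(3)] assms(2)]] noise_measurable]
  by simp

text \<open>All samples of batch \<open>k\<close> share the state \<open>X k\<close>, yet each one
  is independent of that state, of \<open>A\<close> and of the earlier samples of the batch. Adding
  them singly makes each cost the same amount, hence the factor \<open>j\<close> and not its
  square.\<close>

lemma add_batch_second_moment:
  fixes A :: "'w \<Rightarrow> real ^ 'n ^ 'm" and a :: real
  assumes A: "A \<in> borel_measurable (history ({..<k} \<times> {1..B}))"
    and A2: "\<And>u. integrable M (\<lambda>\<omega>. (norm (u v* A \<omega>))\<^sup>2)" and j: "j \<le> B"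
  defines "S \<equiv> \<lambda>\<omega>. A \<omega> + a *\<^sub>R (\<Sum>i = 1..j. noise (X k \<omega>) (\<xi>s k i \<omega>))"
  shows "S \<in> borel_measurable (history ({..<k} \<times> {1..B} \<union> {k} \<times> {1..j})) \<and>
    (\<forall>u. integrable M (\<lambda>\<omega>. (norm (u v* S \<omega>))\<^sup>2) \<and>
      (\<integral>\<omega>. (norm (u v* S \<omega>))\<^sup>2 \<partial>M) \<le> (\<integral>\<omega>. (norm (u v* A \<omega>))\<^sup>2 \<partial>M) + a\<^sup>2 * real j * (norm (u v* V))\<^sup>2)"
  using j unfolding S_def
proof (induction j)
  case 0
  then show ?case using A A2 by simp
next
  case (Suc j)
  let ?J = "\<lambda>j. {..<k} \<times> {1..B} \<union> {k} \<times> {1..j}"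
  let ?S = "\<lambda>j \<omega>. A \<omega> + a *\<^sub>R (\<Sum>i = 1..j. noise (X k \<omega>) (\<xi>s k i \<omega>))"
  let ?z = "\<xi>s k (Suc j)"
  have step: "?S (Suc j) \<omega> = ?S j \<omega> + a *\<^sub>R noise (X k \<omega>) (?z \<omega>)" for \<omega>
    by (simp add: scaleR_add_right)
  have Sj: "?S j \<in> borel_measurable (history (?J j))" using Suc by simp
  have 1: "?S j \<in> borel_measurable (history (?J (Suc j)))"
    by (rule measurable_history_mono[OF Sj]) auto
  have 2: "(\<lambda>\<omega>. noise (X k \<omega>) (?z \<omega>)) \<in> borel_measurable (history (?J (Suc j)))"
    using Suc.prems by (intro noise_history_measurable) auto
  have "?S (Suc j) \<in> borel_measurable (history (?J (Suc j)))"
    unfolding step by (rule borel_measurable_add[OF 1 borel_measurable_scaleR[OF borel_measurable_const 2]])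
  moreover have "integrable M (\<lambda>\<omega>. (norm (u v* ?S (Suc j) \<omega>))\<^sup>2) \<and>
      (\<integral>\<omega>. (norm (u v* ?S (Suc j) \<omega>))\<^sup>2 \<partial>M)
        \<le> (\<integral>\<omega>. (norm (u v* A \<omega>))\<^sup>2 \<partial>M) + a\<^sup>2 * real (Suc j) * (norm (u v* V))\<^sup>2" for u
  proof -
    have uS: "u v* ?S (Suc j) \<omega> = u v* ?S j \<omega> + a *\<^sub>R (u v* noise (X k \<omega>) (?z \<omega>))" for \<omega>
      unfolding step left_mult_add left_mult_scaleR ..
    have "(\<lambda>\<omega>. (u v* ?S j \<omega>, X k \<omega>)) \<in> measurable (history (?J j)) (borel \<Otimes>\<^sub>M borel)"
      by (intro measurable_Pair measurable_compose[OF Sj left_mult_measurable] state_history_measurable) auto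
    note indep = distr_history_sample[OF indep_samples _ _ _ this, of k "Suc j"]
    have J: "?J j \<subseteq> UNIV \<times> {1..B}" "(k, Suc j) \<in> UNIV \<times> {1..B}" "(k, Suc j) \<notin> ?J j" "Suc j \<in> {1..B}"
      using Suc.prems by auto
    have dist: "distr M \<Xi> ?z = distr M \<Xi> \<xi>"
      using samples Suc.prems by (auto simp: iid_copies_def)
    have IH: "integrable M (\<lambda>\<omega>. (norm (u v* ?S j \<omega>))\<^sup>2)"
      "(\<integral>\<omega>. (norm (u v* ?S j \<omega>))\<^sup>2 \<partial>M) \<le> (\<integral>\<omega>. (norm (u v* A \<omega>))\<^sup>2 \<partial>M) + a\<^sup>2 * real j * (norm (u v* V))\<^sup>2"
      using Suc by auto
    define h where "h = (\<lambda>(Y, z). u v* noise Y z)"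
    have h: "h \<in> borel_measurable (borel \<Otimes>\<^sub>M \<Xi>)"
      unfolding h_def using measurable_compose[OF noise_measurable left_mult_measurable[of u]]
      by (simp add: case_prod_unfold)
    note inc = indep_increment_second_moment[OF indep(1)[OF J(1,2,3)] sample_measurable[OF J(4)] indep(2)[OF J(1,2,3)] h, unfolded dist, of "(norm (u v* V))\<^sup>2" a,
        unfolded h_def prod.case, OF left_noise_integrable left_noise_mean
          left_noise_square_integrable left_noise_square_le IH(1)]
    show ?thesis using inc IH(2) unfolding uS by (simp add: algebra_simps)
  qed
  ultimately show ?case by blast
qed

primrec momentum_noise :: "real \<Rightarrow> nat \<Rightarrow> 'w \<Rightarrow> real ^ 'n ^ 'm" where
  "momentum_noise \<theta> 0 \<omega> = (1 / real B) *\<^sub>R (\<Sum>i = 1..B. noise (X 0 \<omega>) (\<xi>s 0 i \<omega>))"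
| "momentum_noise \<theta> (Suc k) \<omega> = (1 - \<theta>) *\<^sub>R momentum_noise \<theta> k \<omega> +
     (\<theta> / real B) *\<^sub>R (\<Sum>i = 1..B. noise (X (Suc k) \<omega>) (\<xi>s (Suc k) i \<omega>))"

text \<open>A batch of \<open>B\<close> samples with coefficient \<open>\<theta> / B\<close>
  contributes \<open>B\<close> times the square of that coefficient, that is
  \<open>\<theta>\<^sup>2 / B\<close>. This is the increment of \<open>noise_weight\<close> divided
  by \<open>B\<close>.\<close>

lemma momentum_noise_second_moment:
  "momentum_noise \<theta> k \<in> borel_measurable (history ({..k} \<times> {1..B})) \<and>
    (\<forall>u. integrable M (\<lambda>\<omega>. (norm (u v* momentum_noise \<theta> k \<omega>))\<^sup>2) \<and>
      (\<integral>\<omega>. (norm (u v* momentum_noise \<theta> k \<omega>))\<^sup>2 \<partial>M) \<le> noise_weight \<theta> k / real B * (norm (u v* V))\<^sup>2)"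
proof (induction k)
  case 0
  have eq: "{..<0::nat} \<times> {1..B} \<union> {0} \<times> {1..B} = {..0} \<times> {1..B}" by auto
  have "momentum_noise \<theta> 0 = (\<lambda>\<omega>. 0 + (1 / real B) *\<^sub>R (\<Sum>i = 1..B. noise (X 0 \<omega>) (\<xi>s 0 i \<omega>)))"
    by (simp add: fun_eq_iff)
  then show ?case
    using add_batch_second_moment[of "\<lambda>_. 0" 0 B "1 / real B"] B_pos unfolding eq
    by (simp add: power2_eq_square)
next
  case (Suc k)
  have eq: "{..<Suc k} \<times> {1..B} \<union> {Suc k} \<times> {1..B} = {..Suc k} \<times> {1..B}" by auto
  let ?A = "\<lambda>\<omega>. (1 - \<theta>) *\<^sub>R momentum_noise \<theta> k \<omega>"
  have m: "momentum_noise \<theta> (Suc k) = (\<lambda>\<omega>. ?A \<omega> +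
      (\<theta> / real B) *\<^sub>R (\<Sum>i = 1..B. noise (X (Suc k) \<omega>) (\<xi>s (Suc k) i \<omega>)))"
    by (simp add: fun_eq_iff)
  have "?A \<in> borel_measurable (history ({..<Suc k} \<times> {1..B}))"
    unfolding lessThan_Suc_atMost using Suc by (intro borel_measurable_scaleR) auto
  moreover have uA: "(norm (u v* ?A \<omega>))\<^sup>2 = (1 - \<theta>)\<^sup>2 * (norm (u v* momentum_noise \<theta> k \<omega>))\<^sup>2" for u \<omega>
    by (simp add: left_mult_scaleR power_mult_distrib)
  then have "integrable M (\<lambda>\<omega>. (norm (u v* ?A \<omega>))\<^sup>2)" for u
    unfolding uA using Suc by simp
  ultimately have *: "momentum_noise \<theta> (Suc k) \<in> borel_measurable (history ({..Suc k} \<times> {1..B})) \<and>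
    (\<forall>u. integrable M (\<lambda>\<omega>. (norm (u v* momentum_noise \<theta> (Suc k) \<omega>))\<^sup>2) \<and>
      (\<integral>\<omega>. (norm (u v* momentum_noise \<theta> (Suc k) \<omega>))\<^sup>2 \<partial>M) \<le>
        (\<integral>\<omega>. (norm (u v* ?A \<omega>))\<^sup>2 \<partial>M) + (\<theta> / real B)\<^sup>2 * real B * (norm (u v* V))\<^sup>2)"
    using add_batch_second_moment[of ?A "Suc k" B "\<theta> / real B"] unfolding eq m by blast
  have "(\<integral>\<omega>. (norm (u v* ?A \<omega>))\<^sup>2 \<partial>M) + (\<theta> / real B)\<^sup>2 * real B * (norm (u v* V))\<^sup>2
      \<le> noise_weight \<theta> (Suc k) / real B * (norm (u v* V))\<^sup>2" for u
  proof -
    have "(\<integral>\<omega>. (norm (u v* ?A \<omega>))\<^sup>2 \<partial>M)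
        \<le> (1 - \<theta>)\<^sup>2 * (noise_weight \<theta> k / real B * (norm (u v* V))\<^sup>2)"
      unfolding uA integral_mult_right_zero using Suc by (intro mult_left_mono) auto
    moreover have "(\<theta> / real B)\<^sup>2 * real B = \<theta>\<^sup>2 / real B"
      using B_pos by (simp add: power2_eq_square)
    ultimately show ?thesis by (simp add: algebra_simps add_divide_distrib)
  qed
  with * show ?case by (meson order_trans)
qed

lemma state_measurable: "X k \<in> borel_measurable M"
  and momentum_noise_measurable: "momentum_noise \<theta> k \<in> borel_measurable M"
proof -
  have "sets (history ({..k} \<times> {1..B})) \<subseteq> sets M"
    by (rule history_algebra_subalgebra) (auto intro: sample_measurable)
  then have "borel_measurable (history ({..k} \<times> {1..B})) \<subseteq> (borel_measurable M :: ('w \<Rightarrow> real ^ 'n ^ 'm) set)"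
    by (intro measurable_mono) auto
  moreover have "{..<k} \<times> {1..B} \<subseteq> {..k} \<times> {1..B}" by auto
  ultimately show "X k \<in> borel_measurable M" "momentum_noise \<theta> k \<in> borel_measurable M"
    using state_history_measurable[of k "{..k} \<times> {1..B}"] momentum_noise_second_moment[of \<theta> k] by auto
qed

lemma batch_gradient_noise:
  "batch_gradient G B \<xi>s X k \<omega> =
     gradf (X k \<omega>) + (1 / real B) *\<^sub>R (\<Sum>i = 1..B. noise (X k \<omega>) (\<xi>s k i \<omega>))"
  using B_pos by (simp add: batch_gradient_def noise_def sum_subtractf sum_constant_scaleR scaleR_diff_right del: sum_constant)

definition momentum_drift :: "real \<Rightarrow> nat \<Rightarrow> 'w \<Rightarrow> real ^ 'n ^ 'm" where
  "momentum_drift \<theta> k \<omega> = momentum G B \<xi>s \<theta> X k \<omega> - gradf (X k \<omega>) - momentum_noise \<theta> k \<omega>"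

text \<open>The first momentum is a full batch gradient, so its error is pure noise; the price is
  the initial value 1 of \<open>noise_weight\<close>.\<close>

lemma momentum_drift_0: "momentum_drift \<theta> 0 \<omega> = 0"
  by (simp add: momentum_drift_def batch_gradient_noise)

text \<open>The fresh batch is the exact gradient plus noise, and its noise cancels against that in
  \<open>momentum_noise\<close>. No fresh sample is left in the recursion, which is why it can be
  estimated separately for each outcome.\<close>

lemma momentum_drift_Suc:
  "momentum_drift \<theta> (Suc k) \<omega> =
     (1 - \<theta>) *\<^sub>R (momentum_drift \<theta> k \<omega> + (gradf (X k \<omega>) - gradf (X (Suc k) \<omega>)))"
  by (simp add: momentum_drift_def batch_gradient_noise algebra_simps)

end

subsection \<open>Convergence rate\<close>

lemma conjugate_exponents_reciprocal:
  assumes "2 \<le> p" "1 \<le> q" "q \<le> 2" and pq: "1 / p + 1 / q = (1 :: ereal)"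
  shows "conjugate_exponents p q"
proof -
  obtain b where b: "q = ereal b" "1 \<le> b" using assms(2,3) by (cases q) auto
  have q1: "1 / q = ereal (1 / b)" using b by (simp add: one_ereal_def)
  show ?thesis
  proof (cases p)
    case (real a)
    then have a: "2 \<le> a" using assms(1) by simp
    then have "1 / a + 1 / b = 1"
      using pq real b by (simp add: one_ereal_def)
    moreover from this have "b \<noteq> 1" using a by auto
    ultimately show ?thesis using a b real by (simp add: conjugate_exponents_def)
  next
    case PInf
    then have "1 / b = 1" using pq q1 by (simp add: one_ereal_def)
    then show ?thesis using PInf b by (simp add: conjugate_exponents_def one_ereal_def)
  qed (use assms(1) in auto)
qed

lemma schatten_norm_minus:
  fixes Z :: "real ^ 'n ^ 'm"
  assumes "1 \<le> r"
  shows "schatten_norm r (- Z) = schatten_norm r Z"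
  using schatten_norm_scaleR[OF assms, of "-1" Z] by simp

text \<open>Integrability is part of the conclusion because the integral of a nonintegrable function
  is 0 by convention, so the inequality alone could hold for the wrong reason. The integrability
  assumptions on \<open>G\<close> likewise make the expectations in the hypotheses genuine.\<close>

theorem theorem2:
  fixes f :: "real ^ 'n ^ 'm \<Rightarrow> real"
    and gradf :: "real ^ 'n ^ 'm \<Rightarrow> real ^ 'n ^ 'm"
    and f_low L \<Delta>f \<sigma> \<theta> \<eta> :: real
    and p q :: ereal
    and V :: "real ^ 'm ^ 'm"
    and M :: "'w measure" and \<Xi> :: "'x measure"
    and \<xi> :: "'w \<Rightarrow> 'x" and \<xi>s :: "nat \<Rightarrow> nat \<Rightarrow> 'w \<Rightarrow> 'x"
    and G :: "real ^ 'n ^ 'm \<Rightarrow> 'x \<Rightarrow> real ^ 'n ^ 'm"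
    and X\<^sub>0 :: "real ^ 'n ^ 'm"
    and X :: "nat \<Rightarrow> 'w \<Rightarrow> real ^ 'n ^ 'm"
    and B K :: nat
  assumes dims: "CARD('m) \<le> CARD('n)"
    and gradient: "\<And>Y. GDERIV f Y :> gradf Y"
    and gradient_continuous: "continuous_on UNIV gradf"
    and lower_bound: "\<And>Y. f_low \<le> f Y"
    and p_range: "2 \<le> p" and q_range: "1 \<le> q" "q \<le> 2"
    and conjugate: "1 / p + 1 / q = 1"
    and L_pos: "0 < L"
    and smooth: "\<And>Y Z. schatten_norm q (gradf Z - gradf Y) \<le> L * schatten_norm p (Z - Y)"
    and prob: "prob_space M"
    and xi_random: "\<xi> \<in> measurable M \<Xi>"
    and G_measurable: "(\<lambda>(Y, x). G Y x) \<in> borel_measurable (borel \<Otimes>\<^sub>M \<Xi>)"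
    and G_integrable: "\<And>Y. integrable M (\<lambda>\<omega>. G Y (\<xi> \<omega>))"
    and G_unbiased: "\<And>Y. (\<integral>\<omega>. G Y (\<xi> \<omega>) \<partial>M) = gradf Y"
    and noise_integrable:
      "\<And>Y. integrable M (\<lambda>\<omega>. (G Y (\<xi> \<omega>) - gradf Y) ** transpose (G Y (\<xi> \<omega>) - gradf Y))"
    and noise_bound:
      "\<And>Y. loewner_le
         (\<integral>\<omega>. (G Y (\<xi> \<omega>) - gradf Y) ** transpose (G Y (\<xi> \<omega>) - gradf Y) \<partial>M) (V ** transpose V)"
    and B_pos: "1 \<le> B" and K_pos: "1 \<le> K"
    and Delta_def: "\<Delta>f = f X\<^sub>0 - f_low"
    and sigma_def: "\<sigma> = schatten_norm q V / sqrt (real B)"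
    and eta_def: "\<eta> = \<theta> / (4 * L)"
    and theta_def:
      "\<theta> = (if \<sigma> = 0 then 1 else min (sqrt ((L * \<Delta>f + \<sigma>\<^sup>2) / (\<sigma>\<^sup>2 * real K))) 1)"
    and samples: "iid_copies M \<Xi> \<xi> B \<xi>s"
    and run: "Sp_Sq_run M \<Xi> G X\<^sub>0 \<theta> p \<eta> B \<xi>s X"
  shows "(\<forall>k<K. integrable M (\<lambda>\<omega>. (schatten_norm q (gradf (X k \<omega>)))\<^sup>2)) \<and>
    (1 / real K) * (\<Sum>k = 0..K - 1. \<integral>\<omega>. (schatten_norm q (gradf (X k \<omega>)))\<^sup>2 \<partial>M)
      \<le> 67 * (sqrt (\<sigma>\<^sup>2 * (L * \<Delta>f + \<sigma>\<^sup>2) / real K) + (L * \<Delta>f + \<sigma>\<^sup>2) / real K)"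
proof -
  have p1: "1 \<le> p" using p_range by (rule order_trans[rotated]) simp
  have pq: "conjugate_exponents p q"
    by (rule conjugate_exponents_reciprocal[OF p_range q_range conjugate])
  have grad_meas [measurable]: "gradf \<in> borel_measurable borel"
    using gradient_continuous by (rule borel_measurable_continuous_onI)
  interpret prob_space M by (rule prob)
  interpret stochastic_gradient_run M gradf V \<Xi> \<xi> \<xi>s G X\<^sub>0 X B
  proof unfold_locales
    show "X 0 \<omega> = X\<^sub>0" if "\<omega> \<in> space M" for \<omega>
      using run that by (simp add: Sp_Sq_run_def)
    show "X (Suc k) \<in> borel_measurable (sample_algebra M \<Xi> B \<xi>s k)" for k
      using run by (simp add: Sp_Sq_run_def)
  qed (rule grad_meas xi_random G_measurable G_integrable G_unbiased noise_integrable noise_bound B_pos samples)+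
  define A where "A = L * \<Delta>f + \<sigma>\<^sup>2"
  have "0 \<le> \<Delta>f" using lower_bound[of X\<^sub>0] by (simp add: Delta_def)
  then have L\<Delta>: "0 \<le> L * \<Delta>f" using L_pos by simp
  have K: "0 < real K" using K_pos by simp
  have \<sigma>A: "\<sigma>\<^sup>2 \<le> A" using L\<Delta> by (simp add: A_def)
  note tradeoff = stepsize_tradeoff[OF \<sigma>A K theta_def[folded A_def]]
  have \<eta>: "0 < \<eta>" using tradeoff(1) L_pos by (simp add: eta_def)
  define R where "R = sqrt (\<sigma>\<^sup>2 * A / real K)"
  let ?s = "\<lambda>k \<omega>. (schatten_norm q (momentum_noise \<theta> k \<omega>))\<^sup>2"
  let ?g = "\<lambda>k \<omega>. (schatten_norm q (gradf (X k \<omega>)))\<^sup>2"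
  let ?C = "144 / 5 * (L * \<Delta>f / \<theta>)"
  have pathwise: "(\<Sum>k<K. ?g k \<omega>) \<le> ?C + 56 / 5 * (\<Sum>k<K. ?s k \<omega>)" if \<omega>: "\<omega> \<in> space M" for \<omega>
  proof -
    define m where "m k = schatten_norm q (momentum G B \<xi>s \<theta> X k \<omega>)" for k
    define e where "e k = schatten_norm q (gradf (X k \<omega>) - momentum G B \<xi>s \<theta> X k \<omega>)" for k
    define d where "d k = schatten_norm q (momentum_drift \<theta> k \<omega>)" for k
    define s where "s k = schatten_norm q (momentum_noise \<theta> k \<omega>)" for k
    define g where "g k = schatten_norm q (gradf (X k \<omega>))" for k
    have min: "is_arg_min
        (\<lambda>Y. inner (momentum G B \<xi>s \<theta> X k \<omega>) (Y - X k \<omega>) + 1 / (2 * \<eta>) * (schatten_norm p (Y - X k \<omega>))\<^sup>2)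
        (\<lambda>_. True) (X (Suc k) \<omega>)" for k
      using run \<omega> by (simp add: Sp_Sq_run_def)
    note step = regularized_step[OF pq p1 \<eta> min, folded m_def]
    have "(\<Sum>k<K. (g k)\<^sup>2) \<le> 144 / 5 * (L * (f (X 0 \<omega>) - f_low) / \<theta>) + 56 / 5 * (\<Sum>k<K. (s k)\<^sup>2)"
    proof (rule momentum_recursion_bound[OF tradeoff(1,2) L_pos eta_def])
      fix k
      show "0 \<le> m k" "0 \<le> e k" "0 \<le> d k" "0 \<le> s k" "0 \<le> g k"
        by (simp_all add: m_def e_def d_def s_def g_def schatten_norm_nonneg)
      show "f_low \<le> f (X k \<omega>)" by (rule lower_bound)
      show "f (X (Suc k) \<omega>) \<le> f (X k \<omega>) - \<eta> * (m k)\<^sup>2 + e k * (\<eta> * m k) + L / 2 * (\<eta> * m k)\<^sup>2"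
      proof -
        let ?D = "X (Suc k) \<omega> - X k \<omega>"
        have "inner (gradf (X k \<omega>) - momentum G B \<xi>s \<theta> X k \<omega>) ?D \<le> e k * (\<eta> * m k)"
          using schatten_Holder[OF pq] step(1)[of k] by (metis e_def)
        then have "inner (gradf (X k \<omega>)) ?D \<le> e k * (\<eta> * m k) - \<eta> * (m k)\<^sup>2"
          using step(2)[of k] by (simp add: inner_diff_left)
        then show ?thesis
          using descent_inequality[OF gradient pq p1 smooth, of "X k \<omega>" ?D] step(1)[of k] by simp
      qed
      show "e k \<le> d k + s k"
      proof -
        have "gradf (X k \<omega>) - momentum G B \<xi>s \<theta> X k \<omega> = - (momentum_drift \<theta> k \<omega> + momentum_noise \<theta> k \<omega>)"
          by (simp add: momentum_drift_def)
        then show ?thesis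
          using schatten_norm_triangle[OF pq] by (simp only: e_def d_def s_def schatten_norm_minus[OF q_range(1)])
      qed
      show "g k \<le> m k + e k"
        using schatten_norm_triangle[OF pq, of "momentum G B \<xi>s \<theta> X k \<omega>"
            "gradf (X k \<omega>) - momentum G B \<xi>s \<theta> X k \<omega>"]
        by (simp add: g_def m_def e_def)
      show "d 0 = 0"
        using schatten_norm_scaleR[OF q_range(1), of 0 0] by (simp add: d_def momentum_drift_0)
      show "d (Suc k) \<le> (1 - \<theta>) * (d k + L * (\<eta> * m k))"
      proof -
        have "schatten_norm p (X k \<omega> - X (Suc k) \<omega>) = \<eta> * m k"
          using step(1)[of k] schatten_norm_minus[OF p1, of "X (Suc k) \<omega> - X k \<omega>"] by simp
        then have "schatten_norm q (gradf (X k \<omega>) - gradf (X (Suc k) \<omega>)) \<le> L * (\<eta> * m k)"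
          using smooth[of "X k \<omega>" "X (Suc k) \<omega>"] by simp
        then have "schatten_norm q (momentum_drift \<theta> k \<omega> + (gradf (X k \<omega>) - gradf (X (Suc k) \<omega>)))
            \<le> d k + L * (\<eta> * m k)"
          unfolding d_def by (intro order_trans[OF schatten_norm_triangle[OF pq]] add_left_mono)
        then show ?thesis
          using tradeoff(2)
          by (simp add: d_def momentum_drift_Suc schatten_norm_scaleR[OF q_range(1)] mult_left_mono)
      qed
    qed
    then show ?thesis using \<omega> by (simp add: g_def s_def start Delta_def)
  qed
  have \<sigma>2: "\<sigma>\<^sup>2 = (schatten_norm q V)\<^sup>2 / real B"
    by (simp add: sigma_def power_divide)
  have s_int: "integrable M (?s k)" and s_le: "(\<integral>\<omega>. ?s k \<omega> \<partial>M) \<le> noise_weight \<theta> k * \<sigma>\<^sup>2" for k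
  proof -
    have "0 \<le> noise_weight \<theta> k / real B" using noise_weight_nonneg by simp
    note S = integral_schatten_norm_square_le[OF pq q_range(2) momentum_noise_measurable _ _ this, of \<theta> k V]
    show "integrable M (?s k)" "(\<integral>\<omega>. ?s k \<omega> \<partial>M) \<le> noise_weight \<theta> k * \<sigma>\<^sup>2"
      using S momentum_noise_second_moment[of \<theta> k] by (simp_all add: \<sigma>2)
  qed
  have bound_int: "integrable M (\<lambda>\<omega>. ?C + 56 / 5 * (\<Sum>k<K. ?s k \<omega>))"
    by (intro Bochner_Integration.integrable_add integrable_mult_right Bochner_Integration.integrable_sum s_int) simp
  \<comment> \<open>Each term is dominated by the pathwise bound, whose right side involves only the
    noise and is integrable.\<close>
  have g_int: "integrable M (?g k)" if k: "k < K" for k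
  proof (rule Bochner_Integration.integrable_bound[OF bound_int])
    have [measurable]: "schatten_norm q \<in> borel_measurable (borel :: (real ^ 'n ^ 'm) measure)"
      by (rule borel_measurable_continuous_onI[OF continuous_on_schatten_norm[OF pq]])
    note [measurable] = state_measurable[of k]
    show "?g k \<in> borel_measurable M" by measurable
    show "AE \<omega> in M. norm (?g k \<omega>) \<le> norm (?C + 56 / 5 * (\<Sum>k<K. ?s k \<omega>))"
    proof (rule AE_I2)
      fix \<omega> assume \<omega>: "\<omega> \<in> space M"
      have "?g k \<omega> \<le> (\<Sum>k<K. ?g k \<omega>)" using k by (intro member_le_sum) auto
      with pathwise[OF \<omega>] show "norm (?g k \<omega>) \<le> norm (?C + 56 / 5 * (\<Sum>k<K. ?s k \<omega>))" by simp
    qed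
  qed
  have "(\<Sum>k<K. \<integral>\<omega>. ?g k \<omega> \<partial>M) = (\<integral>\<omega>. (\<Sum>k<K. ?g k \<omega>) \<partial>M)"
    using g_int by (intro Bochner_Integration.integral_sum[symmetric]) auto
  also have "\<dots> \<le> (\<integral>\<omega>. ?C + 56 / 5 * (\<Sum>k<K. ?s k \<omega>) \<partial>M)"
    using g_int pathwise by (intro integral_mono bound_int Bochner_Integration.integrable_sum) auto
  also have "\<dots> = ?C + 56 / 5 * (\<Sum>k<K. \<integral>\<omega>. ?s k \<omega> \<partial>M)"
    by (simp add: s_int prob_space)
  also have "\<dots> \<le> ?C + 56 / 5 * ((\<theta> * real K + 1 / \<theta>) * \<sigma>\<^sup>2)"
  proof -
    have "(\<Sum>k<K. \<integral>\<omega>. ?s k \<omega> \<partial>M) \<le> (\<Sum>k<K. noise_weight \<theta> k) * \<sigma>\<^sup>2"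
      unfolding sum_distrib_right by (intro sum_mono s_le)
    also have "\<dots> \<le> (\<theta> * real K + 1 / \<theta>) * \<sigma>\<^sup>2"
      by (intro mult_right_mono sum_noise_weight_le tradeoff) auto
    finally show ?thesis by simp
  qed
  finally have "1 / real K * (\<Sum>k<K. \<integral>\<omega>. ?g k \<omega> \<partial>M)
      \<le> 1 / real K * (?C + 56 / 5 * ((\<theta> * real K + 1 / \<theta>) * \<sigma>\<^sup>2))"
    using K by (intro mult_left_mono) auto
  also have "\<dots> = 144 / 5 * (L * \<Delta>f / (\<theta> * real K)) + 56 / 5 * (\<sigma>\<^sup>2 * \<theta>) + 56 / 5 * (\<sigma>\<^sup>2 / (\<theta> * real K))"
    using K tradeoff(1) by (simp add: field_simps)
  \<comment> \<open>Since 56/5 is at most 144/5, both terms with \<open>1 / \<theta>\<close> fit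
    into one multiple of \<open>A\<close>.\<close>
  also have "\<dots> \<le> 144 / 5 * (A / (\<theta> * real K)) + 56 / 5 * (\<sigma>\<^sup>2 * \<theta>)"
  proof -
    have "0 \<le> \<sigma>\<^sup>2 / (\<theta> * real K)" using tradeoff(1) K by simp
    then show ?thesis by (simp add: A_def add_divide_distrib)
  qed
  also have "\<dots> \<le> 144 / 5 * (R + A / real K) + 56 / 5 * R"
    using tradeoff(3,4) unfolding R_def by (intro add_mono mult_left_mono) auto
  \<comment> \<open>The coefficients reached are 144/5 + 56/5 = 40 for \<open>R\<close> and 144/5
    for \<open>A / K\<close>, so 67 leaves room.\<close>
  also have "\<dots> \<le> 67 * (R + A / real K)"
  proof -
    have A0: "0 \<le> A" using \<sigma>A zero_le_power2[of \<sigma>] by linarith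
    have "0 \<le> R" using A0 K by (simp add: R_def)
    moreover have "0 \<le> A / real K" using A0 K by simp
    moreover have "144 / 5 * (x + y) + 56 / 5 * x \<le> 67 * (x + y)" if "0 \<le> x" "0 \<le> y" for x y :: real
      using that by argo
    ultimately show ?thesis by blast
  qed
  finally have "1 / real K * (\<Sum>k<K. \<integral>\<omega>. ?g k \<omega> \<partial>M) \<le> 67 * (R + A / real K)" .
  \<comment> \<open>Subtraction on \<open>nat\<close> truncates, so this identity depends on
    \<open>K\<close> being positive.\<close>
  moreover have "{0..K - 1} = {..<K}" using K_pos by auto
  ultimately show ?thesis using g_int unfolding R_def A_def by simp
qed

end
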